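(* The adversarial two-stage selection problem \textsc{A2ST} under the discrete budgeted uncertainty set $\mathcal{U}^d$, i.e. the problem, for a given $\mathbf{x}\in\Phi_1$, $$\max_{\mathbf{c}\in\mathcal{U}^d}\ \min_{\mathbf{y}\in\Phi_{\mathbf{x}}}\mathbf{c}\mathbf{y},$$ can be solved in $O(n^2)$ time.
   Context: Let $[n]=\{1,\dots,n\}$ and $p\in[n]$. The input consists of $n$, $p$, a vector $\mathbf{x}\in\Phi_1$, nonnegative item costs $\underline{c}_i\le\overline{c}_i$ with $d_i=\overline{c}_i-\underline{c}_i\ge 0$ for $i\in[n]$, and a budget $\Gamma\ge 0$. Products such as $\mathbf{c}\mathbf{y}$ denote $\sum_{i\in[n]}c_iy_i$. $\Phi_1=\{\mathbf{x}\in\{0,1\}^n:\sum_{i\in[n]}x_i\le p\}$. For $\mathbf{x}\in\Phi_1$, $\Phi_{\mathbf{x}}=\{\mathbf{y}\in\{0,1\}^n:\sum_{i\in[n]}(x_i+y_i)=p,\ x_i+y_i\le 1\ \text{for all } i\in[n]\}$. The discrete budgeted uncertainty set is $\mathcal{U}^d=\{(\underline{c}_i+\delta_i)_{i\in[n]}:\delta_i\in\{0,d_i\},\ |\{i\in[n]:\delta_i=d_i\}|\le\Gamma\}$ (that is, at most $\Gamma$ of the items may have their cost raised from $\underline{c}_i$ to $\overline{c}_i$). Running time counts elementary arithmetic operations and comparisons on the input numbers (standard unit-cost model). *)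

theory Defs
  imports Complex_Main "HOL-Library.FuncSet" "HOL-Library.Landau_Symbols"
begin

section \<open>The adversarial two-stage selection problem\<close>

text \<open>
  Vectors indexed by \<open>{1..n}\<close> are extensional functions on \<open>{1..n}\<close>.
\<close>

definition Phi1 :: "nat \<Rightarrow> nat \<Rightarrow> (nat \<Rightarrow> nat) set" where
  "Phi1 n p = {x \<in> {1..n} \<rightarrow>\<^sub>E {0, 1}. (\<Sum>i\<in>{1..n}. x i) \<le> p}"

definition Phi :: "nat \<Rightarrow> nat \<Rightarrow> (nat \<Rightarrow> nat) \<Rightarrow> (nat \<Rightarrow> nat) set" where
  "Phi n p x = {y \<in> {1..n} \<rightarrow>\<^sub>E {0, 1}.
     (\<Sum>i\<in>{1..n}. x i + y i) = p \<and> (\<forall>i\<in>{1..n}. x i + y i \<le> 1)}"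

text \<open>
  The budget bounds the number of items whose cost is actually raised. Counting the items with
  \<open>\<delta> i = hi i - lo i\<close> instead would charge items with \<open>lo i = hi i\<close>, whose cost cannot change,
  and could make the set empty. The budget need not be integral.
\<close>

definition Ud :: "nat \<Rightarrow> (nat \<Rightarrow> real) \<Rightarrow> (nat \<Rightarrow> real) \<Rightarrow> real \<Rightarrow> (nat \<Rightarrow> real) set" where
  "Ud n lo hi \<Gamma> = {(\<lambda>i\<in>{1..n}. lo i + \<delta> i) | \<delta>.
     (\<forall>i\<in>{1..n}. \<delta> i \<in> {0, hi i - lo i}) \<and> real (card {i\<in>{1..n}. \<delta> i \<noteq> 0}) \<le> \<Gamma>}"

definition cost :: "nat \<Rightarrow> (nat \<Rightarrow> real) \<Rightarrow> (nat \<Rightarrow> nat) \<Rightarrow> real" where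
  "cost n c y = (\<Sum>i\<in>{1..n}. c i * real (y i))"

definition min_cost :: "nat \<Rightarrow> nat \<Rightarrow> (nat \<Rightarrow> nat) \<Rightarrow> (nat \<Rightarrow> real) \<Rightarrow> real" where
  "min_cost n p x c = Min (cost n c ` Phi n p x)"

definition a2st_value ::
  "nat \<Rightarrow> nat \<Rightarrow> (nat \<Rightarrow> nat) \<Rightarrow> (nat \<Rightarrow> real) \<Rightarrow> (nat \<Rightarrow> real) \<Rightarrow> real \<Rightarrow> real" where
  "a2st_value n p x lo hi \<Gamma> = Max (min_cost n p x ` Ud n lo hi \<Gamma>)"

definition a2st_instance ::
  "nat \<Rightarrow> nat \<Rightarrow> (nat \<Rightarrow> nat) \<Rightarrow> (nat \<Rightarrow> real) \<Rightarrow> (nat \<Rightarrow> real) \<Rightarrow> real \<Rightarrow> bool" where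
  "a2st_instance n p x lo hi \<Gamma> \<longleftrightarrow>
     p \<in> {1..n} \<and> x \<in> Phi1 n p \<and> (\<forall>i\<in>{1..n}. 0 \<le> lo i \<and> lo i \<le> hi i) \<and> 0 \<le> \<Gamma>"

text \<open>Solving the problem means returning both the optimal value and a worst-case scenario.\<close>

definition a2st_solution ::
  "nat \<Rightarrow> nat \<Rightarrow> (nat \<Rightarrow> nat) \<Rightarrow> (nat \<Rightarrow> real) \<Rightarrow> (nat \<Rightarrow> real) \<Rightarrow> real
     \<Rightarrow> (nat \<Rightarrow> real) \<Rightarrow> real \<Rightarrow> bool" where
  "a2st_solution n p x lo hi \<Gamma> c v \<longleftrightarrow>
     v = a2st_value n p x lo hi \<Gamma> \<and> c \<in> Ud n lo hi \<Gamma> \<and> min_cost n p x c = v"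

text \<open>The sets over which minima and maxima are taken are finite and nonempty.\<close>

lemma finite_Phi: "finite (Phi n p x)"
proof (rule finite_subset)
  show "Phi n p x \<subseteq> {1..n} \<rightarrow>\<^sub>E {0, 1}" by (auto simp: Phi_def)
  show "finite ({1..n} \<rightarrow>\<^sub>E {0, 1::nat})" by (intro finite_PiE) auto
qed

lemma finite_Ud: "finite (Ud n lo hi \<Gamma>)"
proof (rule finite_subset)
  show "Ud n lo hi \<Gamma> \<subseteq> (\<Pi>\<^sub>E i\<in>{1..n}. {lo i, hi i})"
    unfolding Ud_def by (force simp: PiE_iff)
  show "finite (\<Pi>\<^sub>E i\<in>{1..n}. {lo i, hi i})" by (intro finite_PiE) auto
qed

lemma Ud_nonempty: "0 \<le> \<Gamma> \<Longrightarrow> Ud n lo hi \<Gamma> \<noteq> {}"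
  unfolding Ud_def by (auto intro!: exI[of _ "\<lambda>_. 0"])

lemma Phi_nonempty:
  assumes "p \<le> n" and "x \<in> Phi1 n p"
  shows "Phi n p x \<noteq> {}"
proof -
  let ?X = "{i\<in>{1..n}. x i = 1}"
  have x01: "x i = (if i \<in> ?X then 1 else 0)" if "i \<in> {1..n}" for i
    using assms(2) that by (auto simp: Phi1_def PiE_iff)
  have sx: "(\<Sum>i\<in>{1..n}. x i) = card ?X"
  proof -
    have "(\<Sum>i\<in>{1..n}. x i) = (\<Sum>i\<in>{1..n}. if i \<in> ?X then 1 else 0)"
      using x01 by (intro sum.cong) auto
    also have "\<dots> = card ({1..n} \<inter> ?X)" by (subst sum.inter_restrict[symmetric]) auto
    also have "{1..n} \<inter> ?X = ?X" by auto
    finally show ?thesis .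
  qed
  have le: "card ?X \<le> p" using assms(2) sx by (simp add: Phi1_def)
  have "card ({1..n} - ?X) = n - card ?X" by (subst card_Diff_subset) auto
  then have "p - card ?X \<le> card ({1..n} - ?X)" using assms(1) by linarith
  then obtain Y where Y: "Y \<subseteq> {1..n} - ?X" "card Y = p - card ?X"
    by (rule obtain_subset_with_card_n)
  define y where "y = (\<lambda>i\<in>{1..n}. if i \<in> Y then 1 else 0 :: nat)"
  have "(\<Sum>i\<in>{1..n}. y i) = (\<Sum>i\<in>{1..n}. if i \<in> Y then 1 else 0)"
    by (intro sum.cong) (auto simp: y_def)
  also have "\<dots> = card ({1..n} \<inter> Y)" by (subst sum.inter_restrict[symmetric]) auto
  also have "{1..n} \<inter> Y = Y" using Y by auto
  finally have "(\<Sum>i\<in>{1..n}. x i + y i) = p" using Y le sx by (simp add: sum.distrib)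
  moreover have "x i + y i \<le> 1" if "i \<in> {1..n}" for i
  proof (cases "i \<in> Y")
    case True
    then have "x i = 0" using Y(1) by (subst x01[OF that]) auto
    then show ?thesis using True that by (simp add: y_def)
  next
    case False
    then show ?thesis using that by (subst x01[OF that]) (simp add: y_def)
  qed
  moreover have "y \<in> {1..n} \<rightarrow>\<^sub>E {0, 1}" by (auto simp: y_def)
  ultimately have "y \<in> Phi n p x" by (simp add: Phi_def)
  then show ?thesis by blast
qed


section \<open>A unit-cost random access machine over the reals\<close>

text \<open>
  Programs of a small structured language act on natural-number arrays, used for indices and
  combinatorial data, and on real arrays. A scalar variable is cell 0 of an array. Reals can be
  touched only by field operations and comparisons: there is no rounding and no conversion
  from reals to indices. Programs contain integer constants only, so no real number can be used
  as advice. Division by zero yields zero.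
\<close>

type_synonym vname = string

record store =
  nats :: "vname \<Rightarrow> nat \<Rightarrow> nat"
  reals :: "vname \<Rightarrow> nat \<Rightarrow> real"

datatype nexp =
    NConst nat
  | NRead vname nexp
  | NAdd nexp nexp
  | NSub nexp nexp

datatype rexp =
    RConst int
  | RRead vname nexp
  | RAdd rexp rexp
  | RSub rexp rexp
  | RMul rexp rexp
  | RDiv rexp rexp

datatype bexp =
    NLess nexp nexp
  | RLess rexp rexp
  | Neg bexp
  | Conj bexp bexp

datatype com =
    Skip
  | NWrite vname nexp nexp
  | RWrite vname nexp rexp
  | Seq com com
  | Cond bexp com com
  | Loop bexp com

primrec nval :: "nexp \<Rightarrow> store \<Rightarrow> nat" where
  "nval (NConst k) s = k"
| "nval (NRead a i) s = nats s a (nval i s)"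
| "nval (NAdd e f) s = nval e s + nval f s"
| "nval (NSub e f) s = nval e s - nval f s"

primrec rval :: "rexp \<Rightarrow> store \<Rightarrow> real" where
  "rval (RConst k) s = of_int k"
| "rval (RRead a i) s = reals s a (nval i s)"
| "rval (RAdd e f) s = rval e s + rval f s"
| "rval (RSub e f) s = rval e s - rval f s"
| "rval (RMul e f) s = rval e s * rval f s"
| "rval (RDiv e f) s = rval e s / rval f s"

primrec bval :: "bexp \<Rightarrow> store \<Rightarrow> bool" where
  "bval (NLess e f) s = (nval e s < nval f s)"
| "bval (RLess e f) s = (rval e s < rval f s)"
| "bval (Neg b) s = (\<not> bval b s)"
| "bval (Conj b b') s = (bval b s \<and> bval b' s)"

text \<open>
  Every constant, memory access, arithmetic operation, comparison and connective costs one unit.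
\<close>

primrec ntime :: "nexp \<Rightarrow> nat" where
  "ntime (NConst k) = 1"
| "ntime (NRead a i) = 1 + ntime i"
| "ntime (NAdd e f) = 1 + ntime e + ntime f"
| "ntime (NSub e f) = 1 + ntime e + ntime f"

primrec rtime :: "rexp \<Rightarrow> nat" where
  "rtime (RConst k) = 1"
| "rtime (RRead a i) = 1 + ntime i"
| "rtime (RAdd e f) = 1 + rtime e + rtime f"
| "rtime (RSub e f) = 1 + rtime e + rtime f"
| "rtime (RMul e f) = 1 + rtime e + rtime f"
| "rtime (RDiv e f) = 1 + rtime e + rtime f"

primrec btime :: "bexp \<Rightarrow> nat" where
  "btime (NLess e f) = 1 + ntime e + ntime f"
| "btime (RLess e f) = 1 + rtime e + rtime f"
| "btime (Neg b) = 1 + btime b"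
| "btime (Conj b b') = 1 + btime b + btime b'"

definition nwrite :: "vname \<Rightarrow> nat \<Rightarrow> nat \<Rightarrow> store \<Rightarrow> store" where
  "nwrite a i v s = s\<lparr>nats := (nats s)(a := (nats s a)(i := v))\<rparr>"

definition rwrite :: "vname \<Rightarrow> nat \<Rightarrow> real \<Rightarrow> store \<Rightarrow> store" where
  "rwrite a i v s = s\<lparr>reals := (reals s)(a := (reals s a)(i := v))\<rparr>"

text \<open>\<open>exec c s t s'\<close>: started in \<open>s\<close>, program \<open>c\<close> halts in \<open>s'\<close> after time \<open>t\<close>.\<close>

inductive exec :: "com \<Rightarrow> store \<Rightarrow> nat \<Rightarrow> store \<Rightarrow> bool" where
  Skip: "exec Skip s 1 s"
| NWrite: "exec (NWrite a i e) s (1 + ntime i + ntime e) (nwrite a (nval i s) (nval e s) s)"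
| RWrite: "exec (RWrite a i e) s (1 + ntime i + rtime e) (rwrite a (nval i s) (rval e s) s)"
| Seq: "exec c s t s' \<Longrightarrow> exec d s' t' s'' \<Longrightarrow> exec (Seq c d) s (t + t') s''"
| CondTrue: "bval b s \<Longrightarrow> exec c s t s' \<Longrightarrow> exec (Cond b c d) s (1 + btime b + t) s'"
| CondFalse: "\<not> bval b s \<Longrightarrow> exec d s t s' \<Longrightarrow> exec (Cond b c d) s (1 + btime b + t) s'"
| LoopFalse: "\<not> bval b s \<Longrightarrow> exec (Loop b c) s (1 + btime b) s"
| LoopTrue: "bval b s \<Longrightarrow> exec c s t s' \<Longrightarrow> exec (Loop b c) s' t' s''
    \<Longrightarrow> exec (Loop b c) s (1 + btime b + t + t') s''"

inductive_cases exec_cases: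
  "exec Skip s t s'" "exec (NWrite a i e) s t s'" "exec (RWrite a i e) s t s'"
  "exec (Seq c d) s t s'" "exec (Cond b c d) s t s'" "exec (Loop b c) s t s'"

lemma exec_deterministic:
  "exec c s t s' \<Longrightarrow> exec c s u r \<Longrightarrow> u = t \<and> r = s'"
proof (induction arbitrary: u r rule: exec.induct)
  case (Skip s)
  then show ?case by (elim exec_cases) simp
next
  case (NWrite a i e s)
  then show ?case by (elim exec_cases) simp
next
  case (RWrite a i e s)
  then show ?case by (elim exec_cases) simp
next
  case (Seq c s t s' d t' s'')
  from Seq.prems obtain t1 r1 t2 where *:
    "u = t1 + t2" "exec c s t1 r1" "exec d r1 t2 r"
    by (rule exec_cases(4))
  have "t1 = t" "r1 = s'" using Seq.IH(1)[OF *(2)] by simp_all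
  then show ?case using Seq.IH(2)[of t2 r] * by simp
next
  case (CondTrue b s c t s' d)
  from CondTrue.prems obtain t1 where "u = 1 + btime b + t1" "exec c s t1 r"
    by (rule exec_cases(5)) (use CondTrue.hyps in simp_all)
  then show ?case using CondTrue.IH[of t1 r] by simp
next
  case (CondFalse b s d t s' c)
  from CondFalse.prems obtain t1 where "u = 1 + btime b + t1" "exec d s t1 r"
    by (rule exec_cases(5)) (use CondFalse.hyps in simp_all)
  then show ?case using CondFalse.IH[of t1 r] by simp
next
  case (LoopFalse b s c)
  from LoopFalse.prems show ?case
    by (rule exec_cases(6)) (use LoopFalse.hyps in simp_all)
next
  case (LoopTrue b s c t s' t' s'')
  from LoopTrue.prems obtain t1 r1 t2 where *:
    "u = 1 + btime b + t1 + t2" "exec c s t1 r1" "exec (Loop b c) r1 t2 r"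
    by (rule exec_cases(6)) (use LoopTrue.hyps in simp_all)
  have "t1 = t" "r1 = s'" using LoopTrue.IH(1)[OF *(2)] by simp_all
  then show ?case using LoopTrue.IH(2)[of t2 r] * by simp
qed

text \<open>The input is stored as follows; all other memory is initially zero.\<close>

definition a2st_input ::
  "nat \<Rightarrow> nat \<Rightarrow> (nat \<Rightarrow> nat) \<Rightarrow> (nat \<Rightarrow> real) \<Rightarrow> (nat \<Rightarrow> real) \<Rightarrow> real \<Rightarrow> store" where
  "a2st_input n p x lo hi \<Gamma> =
     \<lparr>nats = (\<lambda>a i.
        if a = ''n'' \<and> i = 0 then n
        else if a = ''p'' \<and> i = 0 then p
        else if a = ''x'' \<and> i \<in> {1..n} then x i
        else 0),
      reals = (\<lambda>a i.
        if a = ''lo'' \<and> i \<in> {1..n} then lo i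
        else if a = ''hi'' \<and> i \<in> {1..n} then hi i
        else if a = ''Gamma'' \<and> i = 0 then \<Gamma>
        else 0)\<rparr>"

text \<open>
  On termination the scenario is read off the array \<open>c\<close> and the optimal value off \<open>value\<close>.
\<close>

definition solves_a2st_in_time :: "com \<Rightarrow> (nat \<Rightarrow> nat) \<Rightarrow> bool" where
  "solves_a2st_in_time prog T \<longleftrightarrow>
     (\<forall>n p x lo hi \<Gamma>. a2st_instance n p x lo hi \<Gamma> \<longrightarrow>
        (\<exists>t s. exec prog (a2st_input n p x lo hi \<Gamma>) t s \<and> t \<le> T n \<and>
           a2st_solution n p x lo hi \<Gamma> (restrict (reals s ''c'') {1..n}) (reals s ''value'' 0)))"

end

theory Submission imports Defs begin

text \<open>
  For fixed costs \<open>c\<close> the sum of the \<open>q\<close> smallest entries equals the maximum over \<open>l\<close> of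
  \<open>q * l - (\<Sum>i. max 0 (l - c i))\<close>, and the maximum is attained at \<open>l = 0\<close> (for \<open>q = 0\<close>) or at one of the
  costs. Hence the adversary may first choose one of the \<open>2n\<close> numbers \<open>lo i\<close>, \<open>hi i\<close> as \<open>l\<close>; raising item \<open>i\<close>
  then yields the gain \<open>max 0 (min (l - lo i) (hi i - lo i))\<close> independently of the other items, so that the best
  choice is any set of \<open>\<lfloor>\<Gamma>\<rfloor>\<close> free items of largest gain (all of them if there are fewer). Sorting the items in advance by \<open>hi i - lo i\<close> and by
  \<open>lo i\<close> (quadratic time suffices) makes it possible to discard the items of least gain in linear time
  for each \<open>l\<close>.
\<close>

section \<open>Duality for selection\<close>

text \<open>\<open>dual\<close> is the Lagrangian dual of selecting \<open>q\<close> items, with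
  \<open>l\<close> the multiplier of the cardinality constraint. The multiplier 0 needs no pass,
  since its dual value is 0 for nonnegative costs and the search starts from value 0.

  Items are discarded rather than picked because a gain is a minimum of two terms: over any set of
  items the least one occurs at an item of least slack or at one of greatest lower cost, and both
  orders are independent of \<open>l\<close>. The largest gain cannot be read off the two orders in
  this way. So two lists, sorted once, serve all multipliers, and each pass is linear.

  The machine cannot convert between reals and indices, and \<Gamma> is real. Hence its floor is
  never computed: the number of remaining items is kept as a real and compared with \<Gamma>, and
  \<open>q\<close> is assembled as a real too.\<close>

definition dual :: "nat set \<Rightarrow> nat \<Rightarrow> (nat \<Rightarrow> real) \<Rightarrow> real \<Rightarrow> real" where
  "dual J q c l = real q * l - (\<Sum>i\<in>J. max 0 (l - c i))"

lemma cheapest_subset_exists: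
  fixes c :: "'a \<Rightarrow> real"
  assumes "finite J" "q \<le> card J"
  shows "\<exists>S\<subseteq>J. card S = q \<and> (\<forall>i\<in>S. \<forall>j\<in>J - S. c i \<le> c j)"
  using assms(2)
proof (induction q)
  case 0
  then show ?case by (intro exI[of _ "{}"]) auto
next
  case (Suc q)
  then obtain S where S: "S \<subseteq> J" "card S = q" "\<forall>i\<in>S. \<forall>j\<in>J - S. c i \<le> c j" by auto
  have "J - S \<noteq> {}" using S Suc.prems by auto
  then have "\<exists>m\<in>J - S. \<forall>j\<in>J - S. c m \<le> c j"
    using assms(1) arg_min_if_finite(1)[of "J - S" c] arg_min_least[of "J - S" _ c] by blast
  then obtain m where "m \<in> J - S" "\<forall>j\<in>J - S. c m \<le> c j" by blast
  then show ?case
    using S finite_subset[OF S(1) assms(1)] by (intro exI[of _ "insert m S"]) auto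
qed

text \<open>Weak duality, which holds term by term: for \<open>y i\<close> in {0, 1} each difference
  \<open>l * y i - max 0 (l - c i)\<close> is at most \<open>c i * y i\<close>.\<close>

lemma dual_le_sum:
  assumes "finite J" "\<forall>i\<in>J. y i = 0 \<or> y i = 1" "(\<Sum>i\<in>J. y i) = q"
  shows "dual J q c l \<le> (\<Sum>i\<in>J. c i * real (y i))"
proof -
  have "real q * l = (\<Sum>i\<in>J. l * real (y i))"
    using assms(3) by (simp add: sum_distrib_left[symmetric] mult.commute flip: of_nat_sum)
  moreover have "(\<Sum>i\<in>J. l * real (y i) - max 0 (l - c i)) \<le> (\<Sum>i\<in>J. c i * real (y i))"
    using assms(2) by (intro sum_mono) auto
  ultimately show ?thesis by (simp add: dual_def sum_subtractf)
qed

text \<open>Strong duality. The multiplier is the largest cost in a cheapest set \<open>S\<close>: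
  items outside \<open>S\<close> cost at least that much and contribute nothing to the penalty sum,
  items inside contribute exactly \<open>l - c i\<close>. An empty \<open>S\<close> has no largest
  cost; there 0 serves, because the costs are nonnegative.\<close>

lemma dual_attained:
  assumes "finite J" "q \<le> card J" "\<forall>i\<in>J. 0 \<le> c i"
  shows "\<exists>S\<subseteq>J. card S = q \<and> (\<exists>l\<in>insert 0 (c ` J). sum c S \<le> dual J q c l)"
proof -
  obtain S where S: "S \<subseteq> J" "card S = q" "\<forall>i\<in>S. \<forall>j\<in>J - S. c i \<le> c j"
    using cheapest_subset_exists[OF assms(1,2)] by blast
  have fS: "finite S" using S(1) assms(1) by (rule finite_subset)
  show ?thesis
  proof (cases "S = {}")
    case True
    have "(\<Sum>i\<in>J. max 0 (0 - c i)) = 0" using assms(3) by (intro sum.neutral) auto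
    then have "sum c S \<le> dual J q c 0" using True S(2) by (simp add: dual_def)
    then show ?thesis using S by blast
  next
    case False
    define l where "l = Max (c ` S)"
    have l: "l \<in> c ` S" unfolding l_def using fS False by (intro Max_in) auto
    have le: "c i \<le> l" if "i \<in> S" for i unfolding l_def using fS that by (intro Max_ge) auto
    have "(\<Sum>i\<in>J. max 0 (l - c i)) = (\<Sum>i\<in>S. max 0 (l - c i))"
      using S l assms(1) by (intro sum.mono_neutral_right) (auto simp: max_absorb1)
    also have "\<dots> = (\<Sum>i\<in>S. l - c i)" using le by (intro sum.cong) (auto simp: max_def)
    also have "\<dots> = real q * l - sum c S" using S(2) by (simp add: sum_subtractf)
    finally have "sum c S \<le> dual J q c l" by (simp add: dual_def)
    then show ?thesis using S l by blast
  qed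
qed

text \<open>Only the two set differences matter, and the least value \<open>m\<close> on
  \<open>D - E\<close> separates them. Nonnegativity covers the case that \<open>D\<close> is the
  larger set.\<close>

lemma sum_exchange_le:
  fixes g :: "'a \<Rightarrow> real"
  assumes "finite J" "D \<subseteq> J" "E \<subseteq> J" "card E \<le> card D"
    and "\<forall>i\<in>D. \<forall>j\<in>J - D. g j \<le> g i" "\<forall>i\<in>D. 0 \<le> g i"
  shows "sum g E \<le> sum g D"
proof -
  have fin: "finite D" "finite E" using assms finite_subset by blast+
  have "card (E - D) + card (D \<inter> E) = card E" "card (D - E) + card (D \<inter> E) = card D"
    using fin card_Int_Diff[of E D] card_Int_Diff[of D E] by (simp_all add: Int_commute)
  then have card_le: "card (E - D) \<le> card (D - E)" using assms(4) by linarith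
  have "sum g (E - D) \<le> sum g (D - E)"
  proof (cases "D - E = {}")
    case True
    then have "card (E - D) = 0" using card_le by (metis card.empty le_zero_eq)
    then have "E - D = {}" using fin by simp
    then show ?thesis by (simp only: True)
  next
    case False
    define m where "m = Min (g ` (D - E))"
    have "m \<in> g ` (D - E)" unfolding m_def using fin False by (intro Min_in) auto
    then have m: "0 \<le> m" "\<forall>j\<in>E - D. g j \<le> m" using assms by auto
    have "sum g (E - D) \<le> real (card (E - D)) * m" using m by (intro sum_bounded_above) auto
    also have "\<dots> \<le> real (card (D - E)) * m" using card_le m by (intro mult_right_mono) auto
    also have "\<dots> \<le> sum g (D - E)"
      using fin by (intro sum_bounded_below) (auto simp: m_def)
    finally show ?thesis .
  qed
  moreover have "sum g E = sum g (E - D) + sum g (D \<inter> E)" "sum g D = sum g (D - E) + sum g (D \<inter> E)"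
    using fin sum.Int_Diff[of E g D] sum.Int_Diff[of D g E] by (simp_all add: Int_commute)
  ultimately show ?thesis by linarith
qed

text \<open>Once \<open>l\<close> is fixed, the effect of raising is additive over the raised items.
  This is what choosing \<open>l\<close> before the scenario gains: the adversary's problem becomes
  picking the largest terms.\<close>

lemma dual_raise:
  assumes "finite J" "D \<subseteq> J"
  shows "dual J q (\<lambda>i. if i \<in> D then hi i else lo i) l
    = dual J q lo l + (\<Sum>i\<in>D. max 0 (l - lo i) - max 0 (l - hi i))"
proof -
  have "(\<Sum>i\<in>D. max 0 (l - lo i) - max 0 (l - hi i))
      = (\<Sum>i\<in>J. if i \<in> D then max 0 (l - lo i) - max 0 (l - hi i) else 0)"
    using assms by (simp add: sum.inter_restrict[symmetric] Int_absorb1)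
  also have "\<dots> = (\<Sum>i\<in>J. max 0 (l - lo i) - max 0 (l - (if i \<in> D then hi i else lo i)))"
    by (intro sum.cong) auto
  finally show ?thesis by (simp add: dual_def sum_subtractf)
qed

text \<open>The true gain is the displayed minimum truncated at 0. Truncation is monotone, so
  ordering by the untruncated minimum suffices and the program can compare the two terms
  directly.\<close>

lemma dual_raise_greedy:
  assumes "finite J" "D \<subseteq> J" "E \<subseteq> J" "card E \<le> card D"
    and "\<forall>i\<in>J. lo i \<le> hi i"
    and "\<forall>i\<in>D. \<forall>j\<in>J - D. min (l - lo j) (hi j - lo j) \<le> min (l - lo i) (hi i - lo i)"
  shows "dual J q (\<lambda>i. if i \<in> E then hi i else lo i) l \<le> dual J q (\<lambda>i. if i \<in> D then hi i else lo i) l"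
proof -
  have eq: "max 0 (l - lo i) - max 0 (l - hi i) = max 0 (min (l - lo i) (hi i - lo i))" if "i \<in> J" for i
  proof -
    have "lo i \<le> hi i" using assms(5) that by blast
    then show ?thesis by linarith
  qed
  have "(\<Sum>i\<in>E. max 0 (l - lo i) - max 0 (l - hi i)) \<le> (\<Sum>i\<in>D. max 0 (l - lo i) - max 0 (l - hi i))"
  proof (rule sum_exchange_le[OF assms(1-4)])
    show "\<forall>i\<in>D. \<forall>j\<in>J - D. max 0 (l - lo j) - max 0 (l - hi j) \<le> max 0 (l - lo i) - max 0 (l - hi i)"
    proof (intro ballI)
      fix i j assume ij: "i \<in> D" "j \<in> J - D"
      then have "max 0 (min (l - lo j) (hi j - lo j)) \<le> max 0 (min (l - lo i) (hi i - lo i))"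
        using assms(6) by (intro max.mono) blast+
      then show "max 0 (l - lo j) - max 0 (l - hi j) \<le> max 0 (l - lo i) - max 0 (l - hi i)"
        using eq[of i] eq[of j] ij assms(2) by (metis DiffD1 subsetD)
    qed
    show "\<forall>i\<in>D. 0 \<le> max 0 (l - lo i) - max 0 (l - hi i)"
      using eq assms(2) by (metis max.cobounded1 subsetD)
  qed
  then show ?thesis using assms(1-3) by (simp add: dual_raise)
qed

section \<open>Reasoning about programs\<close>

text \<open>Total correctness with an upper bound in place of the exact time, so that branches of
  different length can share one bound.\<close>

definition runs :: "com \<Rightarrow> store \<Rightarrow> nat \<Rightarrow> (store \<Rightarrow> bool) \<Rightarrow> bool" where
  "runs c s T Q \<longleftrightarrow> (\<exists>t s'. exec c s t s' \<and> t \<le> T \<and> Q s')"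

lemma runsI: "exec c s t s' \<Longrightarrow> t \<le> T \<Longrightarrow> Q s' \<Longrightarrow> runs c s T Q"
  unfolding runs_def by blast

lemma runsE:
  assumes "runs c s T Q"
  obtains t s' where "exec c s t s'" "t \<le> T" "Q s'"
  using assms unfolding runs_def by blast

lemma runs_conseq:
  assumes "runs c s T P" "T \<le> U" "\<And>s'. P s' \<Longrightarrow> Q s'"
  shows "runs c s U Q"
proof -
  obtain t s' where 1: "exec c s t s'" "t \<le> T" "P s'" using assms(1) by (rule runsE)
  then show ?thesis using assms(2,3) by (intro runsI[OF 1(1)]) auto
qed

lemma runs_Seq:
  assumes "runs c s T P" "\<And>s'. P s' \<Longrightarrow> runs d s' U Q"
  shows "runs (Seq c d) s (T + U) Q"
proof -
  obtain t s' where 1: "exec c s t s'" "t \<le> T" "P s'" using assms(1) by (rule runsE)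
  obtain u s'' where "exec d s' u s''" "u \<le> U" "Q s''" using assms(2)[OF 1(3)] by (rule runsE)
  then show ?thesis using 1(2) by (intro runsI[OF exec.Seq[OF 1(1)]]) auto
qed

lemma runs_Cond:
  assumes "bval b s \<Longrightarrow> runs c s T Q" "\<not> bval b s \<Longrightarrow> runs d s T Q"
  shows "runs (Cond b c d) s (1 + btime b + T) Q"
proof (cases "bval b s")
  case True
  then obtain t s' where "exec c s t s'" "t \<le> T" "Q s'" using assms(1) by (auto elim: runsE)
  then show ?thesis by (intro runsI[OF exec.CondTrue[OF True]]) auto
next
  case False
  then obtain t s' where "exec d s t s'" "t \<le> T" "Q s'" using assms(2) by (auto elim: runsE)
  then show ?thesis by (intro runsI[OF exec.CondFalse[OF False]]) auto
qed

text \<open>The measure proves termination and also bounds the number of rounds. The extra 1 pays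
  for the final failing test, charged as a full round.\<close>

lemma runs_Loop:
  fixes \<mu> :: "store \<Rightarrow> nat"
  assumes "I s"
    and "\<And>s. I s \<Longrightarrow> bval b s \<Longrightarrow> runs c s T (\<lambda>s'. I s' \<and> \<mu> s' < \<mu> s)"
  shows "runs (Loop b c) s ((\<mu> s + 1) * (1 + btime b + T)) (\<lambda>s'. I s' \<and> \<not> bval b s')"
  using assms(1)
proof (induction "\<mu> s" arbitrary: s rule: less_induct)
  case less
  show ?case
  proof (cases "bval b s")
    case False
    then show ?thesis using less.prems by (intro runsI[OF exec.LoopFalse]) auto
  next
    case True
    obtain t s' where 1: "exec c s t s'" "t \<le> T" "I s'" "\<mu> s' < \<mu> s"
      using assms(2)[OF less.prems True] by (auto elim: runsE)
    obtain u s'' where 2: "exec (Loop b c) s' u s''" "u \<le> (\<mu> s' + 1) * (1 + btime b + T)"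
      "I s''" "\<not> bval b s''"
      using less.hyps[OF 1(4,3)] by (auto elim: runsE)
    have "(\<mu> s' + 1) * (1 + btime b + T) \<le> \<mu> s * (1 + btime b + T)"
      using 1(4) by (intro mult_le_mono1) simp
    then have "u \<le> \<mu> s * (1 + btime b + T)" using 2(2) by (rule order.trans[rotated])
    then have "1 + btime b + t + u \<le> (\<mu> s + 1) * (1 + btime b + T)" using 1(2) by simp
    then show ?thesis 
      using 2(3,4) by (intro runsI[OF exec.LoopTrue[OF True 1(1) 2(1)]]) auto
  qed
qed

section \<open>Symbolic execution of loop-free code, and counting loops\<close>

primrec loop_free :: "com \<Rightarrow> bool" where
  "loop_free Skip = True"
| "loop_free (NWrite a i e) = True"
| "loop_free (RWrite a i e) = True"
| "loop_free (Seq c d) = (loop_free c \<and> loop_free d)"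
| "loop_free (Cond b c d) = (loop_free c \<and> loop_free d)"
| "loop_free (Loop b c) = False"

primrec outcome :: "com \<Rightarrow> store \<Rightarrow> store" where
  "outcome Skip s = s"
| "outcome (NWrite a i e) s = nwrite a (nval i s) (nval e s) s"
| "outcome (RWrite a i e) s = rwrite a (nval i s) (rval e s) s"
| "outcome (Seq c d) s = outcome d (outcome c s)"
| "outcome (Cond b c d) s = (if bval b s then outcome c s else outcome d s)"
| "outcome (Loop b c) s = s"

text \<open>Both branches of a conditional are charged, which makes the bound independent of the
  store at the price of a constant factor. The clause for \<open>Loop\<close> is a dummy, as in
  \<open>outcome\<close>.\<close>

primrec duration :: "com \<Rightarrow> nat" where
  "duration Skip = 1"
| "duration (NWrite a i e) = 1 + ntime i + ntime e"
| "duration (RWrite a i e) = 1 + ntime i + rtime e"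
| "duration (Seq c d) = duration c + duration d"
| "duration (Cond b c d) = 1 + btime b + duration c + duration d"
| "duration (Loop b c) = 0"

lemma runs_outcome: "loop_free c \<Longrightarrow> runs c s (duration c) (\<lambda>s'. s' = outcome c s)"
proof (induction c arbitrary: s)
  case (Seq c d)
  then show ?case by (auto intro!: runs_Seq)
next
  case (Cond b c d)
  then have "runs c s (duration c) (\<lambda>s'. s' = outcome c s)" "runs d s (duration d) (\<lambda>s'. s' = outcome d s)"
    by simp_all
  then have "runs (Cond b c d) s (1 + btime b + (duration c + duration d)) (\<lambda>s'. s' = outcome (Cond b c d) s)"
    by (intro runs_Cond) (auto elim!: runs_conseq)
  then show ?case by (simp add: add.assoc)
next
  case Skip
  show ?case by (rule runsI[OF exec.Skip]) simp_all
next
  case (NWrite a i e)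
  show ?case by (rule runsI[OF exec.NWrite]) simp_all
next
  case (RWrite a i e)
  show ?case by (rule runsI[OF exec.RWrite]) simp_all
qed simp

lemma runs_loop_free:
  assumes "loop_free c" "duration c \<le> T" "Q (outcome c s)"
  shows "runs c s T Q"
  using runs_outcome[OF assms(1)] by (rule runs_conseq) (use assms in auto)

lemma store_simps [simp]:
  "nats (nwrite a i v s) = (nats s)(a := (nats s a)(i := v))"
  "reals (nwrite a i v s) = reals s"
  "nats (rwrite a i r s) = nats s"
  "reals (rwrite a i r s) = (reals s)(a := (reals s a)(i := r))"
  by (simp_all add: nwrite_def rwrite_def)

abbreviation nvar :: "vname \<Rightarrow> nexp" where "nvar v \<equiv> NRead v (NConst 0)"
abbreviation rvar :: "vname \<Rightarrow> rexp" where "rvar v \<equiv> RRead v (NConst 0)"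
abbreviation incr :: "vname \<Rightarrow> com" where "incr v \<equiv> NWrite v (NConst 0) (NAdd (nvar v) (NConst 1))"

definition For :: "vname \<Rightarrow> com \<Rightarrow> com" where
  "For v c = Seq (NWrite v (NConst 0) (NConst 1)) (Loop (Neg (NLess (nvar ''n'') (nvar v))) (Seq c (incr v)))"

text \<open>\<open>I k\<close> describes the store before round \<open>k\<close>. Per round, 13 is 7
  for the test and 6 for the increment; of the \<open>n + 2\<close> rounds charged, one pays for the
  failing test and one for initialising the counter.\<close>

lemma runs_For:
  assumes "nats s ''n'' 0 = n" "v \<noteq> ''n''"
    and "I 1 (nwrite v 0 1 s)"
    and step: "\<And>k s'. k \<in> {1..n} \<Longrightarrow> I k s' \<Longrightarrow> nats s' v 0 = k \<Longrightarrow> nats s' ''n'' 0 = n \<Longrightarrow>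
      runs c s' T (\<lambda>s''. nats s'' v 0 = k \<and> nats s'' ''n'' 0 = n \<and> I (Suc k) (nwrite v 0 (Suc k) s''))"
    and "\<And>s'. I (Suc n) s' \<Longrightarrow> Q s'"
  shows "runs (For v c) s ((n + 2) * (T + 13)) Q"
proof -
  let ?b = "Neg (NLess (nvar ''n'') (nvar v))"
  define inv where "inv = (\<lambda>s. nats s ''n'' 0 = n \<and> nats s v 0 \<in> {1..Suc n} \<and> I (nats s v 0) s)"
  have body: "runs (Seq c (incr v)) s (T + 6) (\<lambda>s'. inv s' \<and> Suc n - nats s' v 0 < Suc n - nats s v 0)"
    if "inv s" "bval ?b s" for s
  proof (rule runs_Seq)
    have "nats s v 0 \<in> {1..n}" using that by (auto simp: inv_def)
    then show "runs c s T (\<lambda>s''. nats s'' v 0 = nats s v 0 \<and> nats s'' ''n'' 0 = n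
        \<and> I (Suc (nats s v 0)) (nwrite v 0 (Suc (nats s v 0)) s''))"
      using that by (intro step) (auto simp: inv_def)
    fix s'' assume "nats s'' v 0 = nats s v 0 \<and> nats s'' ''n'' 0 = n
        \<and> I (Suc (nats s v 0)) (nwrite v 0 (Suc (nats s v 0)) s'')"
    then show "runs (incr v) s'' 6 (\<lambda>s'. inv s' \<and> Suc n - nats s' v 0 < Suc n - nats s v 0)"
      using \<open>nats s v 0 \<in> {1..n}\<close> assms(2) by (intro runs_loop_free) (auto simp: inv_def)
  qed
  have "runs (For v c) s (3 + (n + 1) * (T + 13)) (\<lambda>s'. inv s' \<and> \<not> bval ?b s')"
    unfolding For_def
  proof (rule runs_Seq)
    show "runs (NWrite v (NConst 0) (NConst 1)) s 3 (\<lambda>s'. inv s' \<and> nats s' v 0 = 1)"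
      using assms by (intro runs_loop_free) (auto simp: inv_def)
    fix s' assume s': "inv s' \<and> nats s' v 0 = 1"
    show "runs (Loop ?b (Seq c (incr v))) s' ((n + 1) * (T + 13)) (\<lambda>s'. inv s' \<and> \<not> bval ?b s')"
      using s' by (intro runs_conseq[OF runs_Loop[of inv s' ?b _ "T + 6" "\<lambda>s. Suc n - nats s v 0", OF _ body]]) auto
  qed
  then show ?thesis
  proof (rule runs_conseq)
    fix s' assume "inv s' \<and> \<not> bval ?b s'"
    then have "I (Suc n) s'" by (auto simp: inv_def dest: le_antisym)
    then show "Q s'" by (rule assms(5))
  qed simp
qed

definition agree :: "vname set \<Rightarrow> vname set \<Rightarrow> store \<Rightarrow> store \<Rightarrow> bool" where
  "agree A B s s' \<longleftrightarrow> (\<forall>a. a \<notin> A \<longrightarrow> nats s' a = nats s a) \<and> (\<forall>a. a \<notin> B \<longrightarrow> reals s' a = reals s a)"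

lemma agree_refl: "agree A B s s"
  by (simp add: agree_def)

lemma agree_trans: "agree A B s s' \<Longrightarrow> agree C D s' s'' \<Longrightarrow> A \<union> C \<subseteq> E \<Longrightarrow> B \<union> D \<subseteq> F \<Longrightarrow> agree E F s s''"
  unfolding agree_def by (metis Un_iff subset_iff)

text \<open>The form used for the linear passes. \<open>A\<close> and \<open>B\<close> are the
  arrays that the pass may write; \<open>I\<close> must ignore the counter, so the increment
  disappears from the obligation for the body, which becomes a computation with
  \<open>outcome\<close>.\<close>

lemma runs_For_loop_free:
  assumes "nats s ''n'' 0 = n" "''n'' \<notin> A" "v \<in> A" "loop_free c" "duration c \<le> T"
    and "\<And>k t a. I k (nwrite v 0 a t) = I k t" "I 1 s"
    and body: "\<And>k s'. k \<in> {1..n} \<Longrightarrow> agree A B s s' \<Longrightarrow> nats s' v 0 = k \<Longrightarrow> I k s' \<Longrightarrow>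
      agree A B s' (outcome c s') \<and> nats (outcome c s') v 0 = k \<and> I (Suc k) (outcome c s')"
  shows "runs (For v c) s ((n + 2) * (T + 13)) (\<lambda>s'. agree A B s s' \<and> I (Suc n) s')"
proof (rule runs_For[where I = "\<lambda>k s'. agree A B s s' \<and> I k s'"])
  have nwrite_agree: "agree A B s t \<Longrightarrow> agree A B s (nwrite v 0 a t)" for t a
    using assms(3) by (auto simp: agree_def)
  show "v \<noteq> ''n''" using assms(2,3) by blast
  show "agree A B s (nwrite v 0 1 s) \<and> I 1 (nwrite v 0 1 s)"
    using assms(6,7) nwrite_agree[OF agree_refl] by simp
  fix k s' assume k: "k \<in> {1..n}" "agree A B s s' \<and> I k s'" "nats s' v 0 = k" "nats s' ''n'' 0 = n"
  let ?s = "outcome c s'"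
  have *: "agree A B s' ?s" "nats ?s v 0 = k" "I (Suc k) ?s" using body[OF k(1) _ k(3)] k(2) by auto
  have "nats ?s ''n'' 0 = n" using *(1) assms(2) k(4) by (simp add: agree_def)
  moreover have "agree A B s ?s" using k(2) *(1) by (auto intro: agree_trans)
  ultimately show "runs c s' T (\<lambda>s''. nats s'' v 0 = k \<and> nats s'' ''n'' 0 = n \<and>
      agree A B s (nwrite v 0 (Suc k) s'') \<and> I (Suc k) (nwrite v 0 (Suc k) s''))"
    using assms(4-6) * nwrite_agree by (intro runs_loop_free) auto
qed (use assms(1) in auto)

section \<open>Sorting by counting\<close>

text \<open>Ties are broken by index, so this is a strict total order even for equal keys and ranks
  are distinct. Only strict comparisons occur, as the machine has no others.\<close>

definition precedes :: "(nat \<Rightarrow> real) \<Rightarrow> nat \<Rightarrow> nat \<Rightarrow> bool" where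
  "precedes key j i \<longleftrightarrow> key j < key i \<or> (\<not> key i < key j \<and> j < i)"

definition rank :: "(nat \<Rightarrow> real) \<Rightarrow> nat \<Rightarrow> nat \<Rightarrow> nat" where
  "rank key n i = card {j\<in>{1..n}. precedes key j i}"

lemma precedes_irrefl: "\<not> precedes key i i"
  by (simp add: precedes_def)

lemma precedes_trans: "precedes key k i \<Longrightarrow> precedes key i j \<Longrightarrow> precedes key k j"
  unfolding precedes_def by linarith

lemma precedes_total: "i \<noteq> j \<Longrightarrow> precedes key i j \<or> precedes key j i"
  unfolding precedes_def by linarith

text \<open>By transitivity every predecessor of \<open>i\<close> precedes \<open>j\<close>, and
  \<open>i\<close> itself is one more.\<close>

lemma rank_strict_mono:
  assumes "i \<in> {1..n}" "precedes key i j"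
  shows "rank key n i < rank key n j"
  unfolding rank_def
proof (rule psubset_card_mono)
  show "{k\<in>{1..n}. precedes key k i} \<subset> {k\<in>{1..n}. precedes key k j}"
    using assms precedes_trans[OF _ assms(2)] precedes_irrefl[of key i] by auto
qed simp

lemma key_le_of_rank_le:
  assumes "j \<in> {1..n}" "rank key n i \<le> rank key n j"
  shows "key i \<le> key j"
proof (rule ccontr)
  assume "\<not> key i \<le> key j"
  then have "precedes key j i" by (simp add: precedes_def)
  then show False using rank_strict_mono[OF assms(1), of key i] assms(2) by simp
qed

lemma rank_less:
  assumes "i \<in> {1..n}"
  shows "rank key n i < n"
proof -
  have "{j\<in>{1..n}. precedes key j i} \<subset> {1..n}" using assms precedes_irrefl[of key i] by blast
  then have "rank key n i < card {1..n}" unfolding rank_def by (intro psubset_card_mono) auto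
  then show ?thesis by simp
qed

lemma rank_eq_iff:
  assumes "i \<in> {1..n}" "j \<in> {1..n}"
  shows "rank key n i = rank key n j \<longleftrightarrow> i = j"
  using precedes_total[of i j key] rank_strict_mono[OF assms(1), of key j] rank_strict_mono[OF assms(2), of key i]
  by fastforce

text \<open>Ranks are injective and lie below \<open>n\<close>. Thus items are numbered from 1 but
  the sorted lists fill the cells from 0 to \<open>n - 1\<close> without gaps.\<close>

lemma rank_image: "rank key n ` {1..n} = {..<n}"
proof (rule card_subset_eq)
  show "rank key n ` {1..n} \<subseteq> {..<n}" using rank_less by auto
  have "inj_on (rank key n) {1..n}" by (rule inj_onI) (metis rank_eq_iff)
  then show "card (rank key n ` {1..n}) = card {..<n}" by (simp add: card_image)
qed simp

text \<open>A disjunction written by de Morgan's law, since the language offers only negation and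
  conjunction.\<close>

definition precedes_test :: "vname \<Rightarrow> bexp" where
  "precedes_test K =
     (Neg (Conj (Neg (RLess (RRead K (nvar ''j'')) (RRead K (nvar ''i''))))
       (Neg (Conj (Neg (RLess (RRead K (nvar ''i'')) (RRead K (nvar ''j'')))) (NLess (nvar ''j'') (nvar ''i''))))))"

lemma precedes_test [simp]:
  "bval (precedes_test K) s = precedes (reals s K) (nats s ''j'' 0) (nats s ''i'' 0)"
  "btime (precedes_test K) = 25"
  by (auto simp: precedes_test_def precedes_def)

definition count_rank :: "vname \<Rightarrow> com" where
  "count_rank K = For ''j'' (Cond (precedes_test K) (incr ''r'') Skip)"

definition sort_by :: "vname \<Rightarrow> vname \<Rightarrow> com" where
  "sort_by K P = For ''i'' (Seq (NWrite ''r'' (NConst 0) (NConst 0))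
     (Seq (count_rank K) (NWrite P (nvar ''r'') (nvar ''i''))))"

lemma runs_count_rank:
  assumes "nats s ''n'' 0 = n" "nats s ''r'' 0 = 0"
  shows "runs (count_rank K) s ((n + 2) * 60)
    (\<lambda>s'. agree {''j'', ''r''} {} s s' \<and> nats s' ''r'' 0 = rank (reals s K) n (nats s ''i'' 0))"
proof -
  let ?i = "nats s ''i'' 0" and ?key = "reals s K"
  have card_step: "card {j\<in>{1..<Suc k}. precedes ?key j ?i}
      = card {j\<in>{1..<k}. precedes ?key j ?i} + (if precedes ?key k ?i then 1 else 0)"
    if "1 \<le> k" for k
  proof -
    have "{j\<in>{1..<Suc k}. precedes ?key j ?i}
        = (if precedes ?key k ?i then insert k else id) {j\<in>{1..<k}. precedes ?key j ?i}"
      using that by (auto simp: less_Suc_eq)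
    then show ?thesis by simp
  qed
  define I where "I = (\<lambda>k (s' :: store). agree {''j'', ''r''} {} s s'
    \<and> nats s' ''r'' 0 = card {j\<in>{1..<k}. precedes ?key j ?i})"
  show ?thesis unfolding count_rank_def
  proof (rule runs_conseq[OF runs_For[where I = I and T = 40 and Q = "I (Suc n)"]])
    show "I 1 (nwrite ''j'' 0 1 s)" using assms by (simp add: I_def agree_def)
    show "I (Suc n) s' \<Longrightarrow> agree {''j'', ''r''} {} s s' \<and> nats s' ''r'' 0 = rank ?key n ?i" for s'
      unfolding I_def rank_def atLeastLessThanSuc_atLeastAtMost .
    fix k s' assume k: "k \<in> {1..n}" "I k s'" "nats s' ''j'' 0 = k" "nats s' ''n'' 0 = n"
    then have eq: "reals s' K = ?key" "nats s' ''i'' 0 = ?i" by (auto simp: I_def agree_def)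
    show "runs (Cond (precedes_test K) (incr ''r'') Skip) s' 40
      (\<lambda>s''. nats s'' ''j'' 0 = k \<and> nats s'' ''n'' 0 = n \<and> I (Suc k) (nwrite ''j'' 0 (Suc k) s''))"
    proof (rule runs_loop_free)
      have "nats s' ''r'' 0 = card {j\<in>{1..<k}. precedes ?key j ?i}" "agree {''j'', ''r''} {} s s'" "1 \<le> k"
        using k(1,2) by (auto simp only: I_def atLeastAtMost_iff)
      then show "nats (outcome (Cond (precedes_test K) (incr ''r'') Skip) s') ''j'' 0 = k \<and>
        nats (outcome (Cond (precedes_test K) (incr ''r'') Skip) s') ''n'' 0 = n \<and>
        I (Suc k) (nwrite ''j'' 0 (Suc k) (outcome (Cond (precedes_test K) (incr ''r'') Skip) s'))"
        by (simp add: k(3,4) eq assms(1) I_def agree_def card_step[simplified])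
    qed simp_all
  qed (use assms in auto)
qed

text \<open>Each item is written into the cell given by its rank; distinct ranks ensure that no item
  placed earlier is overwritten (\<open>rk_neq\<close>).\<close>

lemma runs_sort_by:
  assumes "nats s ''n'' 0 = n" "P \<notin> {''n'', ''i'', ''j'', ''r''}"
  shows "runs (sort_by K P) s ((n + 2) * ((n + 2) * 60 + 30))
    (\<lambda>s'. agree {''i'', ''j'', ''r'', P} {} s s' \<and> (\<forall>i\<in>{1..n}. nats s' P (rank (reals s K) n i) = i))"
proof -
  let ?rk = "rank (reals s K) n"
  define I where "I = (\<lambda>k (s' :: store). agree {''i'', ''j'', ''r'', P} {} s s' \<and> (\<forall>i\<in>{1..<k}. nats s' P (?rk i) = i))"
  have rk_neq: "?rk i \<noteq> ?rk k" if "i \<in> {1..<k}" "k \<in> {1..n}" for i k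
    using that rank_eq_iff[of i n k] by simp
  show ?thesis unfolding sort_by_def
  proof (rule runs_conseq[OF runs_For[where I = I and T = "3 + ((n + 2) * 60 + 5)" and Q = "I (Suc n)"]])
    show "(n + 2) * (3 + ((n + 2) * 60 + 5) + 13) \<le> (n + 2) * ((n + 2) * 60 + 30)"
      by (intro mult_le_mono2) simp
    show "I 1 (nwrite ''i'' 0 1 s)" using assms by (simp add: I_def agree_def)
    show "I (Suc n) s' \<Longrightarrow> agree {''i'', ''j'', ''r'', P} {} s s' \<and> (\<forall>i\<in>{1..n}. nats s' P (?rk i) = i)" for s'
      by (simp add: I_def atLeastLessThanSuc_atLeastAtMost)
    fix k s' assume k: "k \<in> {1..n}" "I k s'" "nats s' ''i'' 0 = k" "nats s' ''n'' 0 = n"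
    have key: "reals s' K = reals s K" using k(2) by (simp add: I_def agree_def)
    show "runs (Seq (NWrite ''r'' (NConst 0) (NConst 0))
        (Seq (count_rank K) (NWrite P (nvar ''r'') (nvar ''i'')))) s' (3 + ((n + 2) * 60 + 5))
      (\<lambda>s''. nats s'' ''i'' 0 = k \<and> nats s'' ''n'' 0 = n \<and> I (Suc k) (nwrite ''i'' 0 (Suc k) s''))"
    proof (intro runs_Seq)
      show "runs (NWrite ''r'' (NConst 0) (NConst 0)) s' 3 (\<lambda>t. t = nwrite ''r'' 0 0 s')"
        by (intro runs_loop_free) auto
      fix t assume t: "t = nwrite ''r'' 0 0 s'"
      show "runs (count_rank K) t ((n + 2) * 60)
        (\<lambda>s'. agree {''j'', ''r''} {} t s' \<and> nats s' ''r'' 0 = rank (reals t K) n (nats t ''i'' 0))"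
        using k(4) t by (intro runs_count_rank) auto
      fix u assume u: "agree {''j'', ''r''} {} t u \<and> nats u ''r'' 0 = rank (reals t K) n (nats t ''i'' 0)"
      have ui: "nats u ''i'' 0 = k" "nats u ''n'' 0 = n" "nats u ''r'' 0 = ?rk k" "nats u P = nats s' P"
        using u t k key assms(2) by (auto simp: agree_def)
      have ag: "agree {''i'', ''j'', ''r'', P} {} s u"
        using u k(2) unfolding I_def t by (auto simp: agree_def)
      show "runs (NWrite P (nvar ''r'') (nvar ''i'')) u 5
        (\<lambda>s''. nats s'' ''i'' 0 = k \<and> nats s'' ''n'' 0 = n \<and> I (Suc k) (nwrite ''i'' 0 (Suc k) s''))"
      proof (rule runs_loop_free)
        have "((nats u P)(?rk k := k)) (?rk i) = i" if "i \<in> {1..<Suc k}" for i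
        proof (cases "i = k")
          case False
          then have i: "i \<in> {1..<k}" using that by simp
          have "nats s' P (?rk i) = i" using k(2) i unfolding I_def by blast
          then show ?thesis using rk_neq[OF i k(1)] ui(4) by simp
        qed simp
        then have "\<forall>i\<in>{1..<Suc k}. ((nats u P)(?rk k := k)) (?rk i) = i" ..
        moreover have "''n'' \<noteq> P" "''i'' \<noteq> P" "''j'' \<noteq> P" "''r'' \<noteq> P" using assms(2) by auto
        ultimately show "nats (outcome (NWrite P (nvar ''r'') (nvar ''i'')) u) ''i'' 0 = k \<and>
          nats (outcome (NWrite P (nvar ''r'') (nvar ''i'')) u) ''n'' 0 = n \<and>
          I (Suc k) (nwrite ''i'' 0 (Suc k) (outcome (NWrite P (nvar ''r'') (nvar ''i'')) u))"
          using ui(1-3) ag assms by (simp add: I_def agree_def)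
      qed simp_all
    qed
  qed (use assms in auto)
qed

section \<open>The algorithm\<close>

text \<open>No expression turns an index into a real, so \<open>q\<close> is counted in the real
  array: plus 1 for each index up to \<open>p\<close>, minus 1 for each item taken by
  \<open>x\<close>. The array \<open>e\<close> holds negated lower costs, so that ascending order
  puts the greatest lower cost first. \<open>c\<close> starts as the scenario without raised
  items.\<close>

definition prepare :: com where
  "prepare = For ''i'' (Seq (RWrite ''d'' (nvar ''i'') (RSub (RRead ''hi'' (nvar ''i'')) (RRead ''lo'' (nvar ''i''))))
     (Seq (RWrite ''e'' (nvar ''i'') (RSub (RConst 0) (RRead ''lo'' (nvar ''i''))))
     (Seq (RWrite ''c'' (nvar ''i'') (RRead ''lo'' (nvar ''i'')))
     (Seq (Cond (Neg (NLess (nvar ''p'') (nvar ''i'')))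
        (RWrite ''q'' (NConst 0) (RAdd (rvar ''q'') (RConst 1))) Skip)
      (Cond (NLess (NConst 0) (NRead ''x'' (nvar ''i'')))
        (RWrite ''q'' (NConst 0) (RSub (rvar ''q'') (RConst 1))) Skip)))))"

definition mark :: com where
  "mark = For ''j'' (Cond (NLess (NConst 0) (NRead ''x'' (nvar ''j'')))
     (NWrite ''in'' (nvar ''j'') (NConst 0))
     (Seq (NWrite ''in'' (nvar ''j'') (NConst 1))
       (RWrite ''rem'' (NConst 0) (RAdd (rvar ''rem'') (RConst 1)))))"

text \<open>One step does a single thing: it moves a pointer past an item already discarded, or
  discards one item. A pointer is not moved on discarding; a later step does that if the removal
  goes on.\<close>

definition step :: com where
  "step = Cond (Neg (NLess (NConst 0) (NRead ''in'' (NRead ''P'' (nvar ''a''))))) (incr ''a'')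
    (Cond (Neg (NLess (NConst 0) (NRead ''in'' (NRead ''Q'' (nvar ''b''))))) (incr ''b'')
    (Seq (RWrite ''rem'' (NConst 0) (RSub (rvar ''rem'') (RConst 1)))
    (Cond (RLess (RRead ''d'' (NRead ''P'' (nvar ''a'')))
        (RSub (rvar ''lam'') (RRead ''lo'' (NRead ''Q'' (nvar ''b'')))))
      (NWrite ''in'' (NRead ''P'' (nvar ''a'')) (NConst 0))
      (NWrite ''in'' (NRead ''Q'' (nvar ''b'')) (NConst 0)))))"

definition remove :: com where
  "remove = Loop (RLess (rvar ''Gamma'') (rvar ''rem'')) step"

definition evaluate :: com where
  "evaluate = For ''j'' (Seq (Cond (NLess (NConst 0) (NRead ''in'' (nvar ''j'')))
      (RWrite ''w'' (nvar ''j'') (RRead ''hi'' (nvar ''j'')))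
      (RWrite ''w'' (nvar ''j'') (RRead ''lo'' (nvar ''j''))))
    (Cond (Conj (Neg (NLess (NConst 0) (NRead ''x'' (nvar ''j'')))) (RLess (RRead ''w'' (nvar ''j'')) (rvar ''lam'')))
      (RWrite ''val'' (NConst 0) (RSub (rvar ''val'') (RSub (rvar ''lam'') (RRead ''w'' (nvar ''j'')))))
      Skip))"

definition record_best :: com where
  "record_best = Cond (RLess (rvar ''value'') (rvar ''val''))
    (Seq (RWrite ''value'' (NConst 0) (rvar ''val''))
      (For ''j'' (RWrite ''c'' (nvar ''j'') (RRead ''w'' (nvar ''j'')))))
    Skip"

definition start_with :: "vname \<Rightarrow> com" where
  "start_with K = Seq (RWrite ''lam'' (NConst 0) (RRead K (nvar ''i'')))
    (Seq (RWrite ''val'' (NConst 0) (RMul (rvar ''q'') (rvar ''lam'')))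
    (Seq (RWrite ''rem'' (NConst 0) (RConst 0))
    (Seq (NWrite ''a'' (NConst 0) (NConst 0)) (NWrite ''b'' (NConst 0) (NConst 0)))))"

definition examine :: "vname \<Rightarrow> com" where
  "examine K = Seq (start_with K) (Seq mark (Seq remove (Seq evaluate record_best)))"

definition algorithm :: com where
  "algorithm = Seq prepare (Seq (sort_by ''d'' ''P'') (Seq (sort_by ''e'' ''Q'')
     (For ''i'' (Seq (examine ''lo'') (examine ''hi'')))))"

lemma rank_cong:
  assumes "\<forall>i\<in>{1..n}. key i = key' i" "i \<in> {1..n}"
  shows "rank key n i = rank key' n i"
proof -
  have "{j\<in>{1..n}. precedes key j i} = {j\<in>{1..n}. precedes key' j i}"
    using assms by (auto simp: precedes_def)
  then show ?thesis by (simp add: rank_def)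
qed

section \<open>Duality for a fixed instance\<close>

locale a2st =
  fixes n p :: nat and x :: "nat \<Rightarrow> nat" and lo hi :: "nat \<Rightarrow> real" and \<Gamma> :: real
  assumes instance_ok: "a2st_instance n p x lo hi \<Gamma>"
begin

definition J :: "nat set" where "J = {i\<in>{1..n}. x i = 0}"
definition q :: nat where "q = p - (\<Sum>i\<in>{1..n}. x i)"
definition scen :: "nat set \<Rightarrow> nat \<Rightarrow> real" where "scen D i = (if i \<in> D then hi i else lo i)"
definition feasible :: "nat set \<Rightarrow> bool" where "feasible D \<longleftrightarrow> D \<subseteq> J \<and> real (card D) \<le> \<Gamma>"
definition gain :: "real \<Rightarrow> nat \<Rightarrow> real" where "gain l i = min (l - lo i) (hi i - lo i)"

lemma finite_J [simp]: "finite J"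
  by (simp add: J_def)

lemma J_subset: "J \<subseteq> {1..n}"
  by (auto simp: J_def)

lemma lo_hi: "i \<in> {1..n} \<Longrightarrow> 0 \<le> lo i \<and> lo i \<le> hi i"
  using instance_ok by (simp add: a2st_instance_def)

lemma x_cases: "i \<in> {1..n} \<Longrightarrow> x i = 0 \<or> x i = 1"
  using instance_ok by (auto simp: a2st_instance_def Phi1_def PiE_iff)

lemma Gamma_nonneg: "0 \<le> \<Gamma>" and p_le: "p \<le> n" and sum_x_le: "(\<Sum>i\<in>{1..n}. x i) \<le> p"
  using instance_ok by (auto simp: a2st_instance_def Phi1_def)

lemma sum_split_J:
  fixes f :: "nat \<Rightarrow> 'b::comm_monoid_add"
  assumes "\<And>i. i \<in> {1..n} - J \<Longrightarrow> f i = 0"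
  shows "sum f {1..n} = sum f J"
  using assms J_subset by (intro sum.mono_neutral_right) auto

text \<open>Exactly \<open>n - card J\<close> items are taken by \<open>x\<close>, and at most
  \<open>n\<close> are wanted in total.\<close>

lemma q_le_card_J: "q \<le> card J"
proof -
  have "(\<Sum>i\<in>{1..n}. x i) = (\<Sum>i\<in>{1..n} - J. x i)"
    by (intro sum.mono_neutral_right) (auto simp: J_def)
  also have "\<dots> = (\<Sum>i\<in>{1..n} - J. 1)" 
  proof (rule sum.cong)
    fix i assume "i \<in> {1..n} - J"
    then show "x i = 1" using x_cases[of i] by (auto simp: J_def)
  qed simp
  also have "\<dots> = n - card J" using J_subset by (simp add: card_Diff_subset)
  finally show ?thesis using p_le unfolding q_def by linarith
qed

lemma PhiD:
  assumes "y \<in> Phi n p x"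
  shows "\<forall>i\<in>J. y i = 0 \<or> y i = 1" "(\<Sum>i\<in>J. y i) = q" "cost n c y = (\<Sum>i\<in>J. c i * real (y i))"
proof -
  have y: "y i = 0 \<or> y i = 1" "x i + y i \<le> 1" if "i \<in> {1..n}" for i
    using assms that by (auto simp: Phi_def PiE_iff)
  have zero: "y i = 0" if "i \<in> {1..n} - J" for i
    using y(2)[of i] x_cases[of i] that by (auto simp: J_def)
  show "\<forall>i\<in>J. y i = 0 \<or> y i = 1" using y J_subset by blast
  have "(\<Sum>i\<in>{1..n}. y i) = q" using assms by (auto simp: Phi_def q_def sum.distrib)
  then show "(\<Sum>i\<in>J. y i) = q" using sum_split_J[of y] zero by simp
  show "cost n c y = (\<Sum>i\<in>J. c i * real (y i))"
    unfolding cost_def by (rule sum_split_J) (simp add: zero)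
qed

lemma indicator_in_Phi:
  assumes "S \<subseteq> J" "card S = q"
  shows "\<exists>y\<in>Phi n p x. cost n c y = sum c S"
proof
  define y where "y = (\<lambda>i\<in>{1..n}. if i \<in> S then 1 else 0 :: nat)"
  have S: "S \<subseteq> {1..n}" "finite S" using assms J_subset finite_subset[of S J] by auto
  have "(\<Sum>i\<in>{1..n}. y i) = (\<Sum>i\<in>{1..n}. if i \<in> S then 1 else 0)" by (intro sum.cong) (auto simp: y_def)
  also have "\<dots> = card S" using S by (simp add: sum.inter_restrict[symmetric] Int_absorb1)
  finally have "(\<Sum>i\<in>{1..n}. x i + y i) = p" using assms(2) sum_x_le by (simp add: sum.distrib q_def)
  moreover have "\<forall>i\<in>{1..n}. x i + y i \<le> 1"
  proof
    fix i assume i: "i \<in> {1..n}"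
    have "x i = 0" if "i \<in> S" using that assms(1) by (auto simp: J_def)
    then show "x i + y i \<le> 1" using x_cases[OF i] i by (auto simp: y_def)
  qed
  ultimately show "y \<in> Phi n p x" by (auto simp: Phi_def y_def)
  have "cost n c y = (\<Sum>i\<in>{1..n}. if i \<in> S then c i else 0)"
    unfolding cost_def by (intro sum.cong) (auto simp: y_def)
  also have "\<dots> = sum c S" using S by (simp add: sum.inter_restrict[symmetric] Int_absorb1)
  finally show "cost n c y = sum c S" .
qed

lemma Phi_ne: "Phi n p x \<noteq> {}"
  using instance_ok by (intro Phi_nonempty) (auto simp: a2st_instance_def)

lemma dual_le_min_cost: "dual J q c l \<le> min_cost n p x c"
  unfolding min_cost_def
proof (intro Min.boundedI)
  fix v assume "v \<in> cost n c ` Phi n p x"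
  then obtain y where y: "y \<in> Phi n p x" "v = cost n c y" by blast
  show "dual J q c l \<le> v" unfolding y(2) PhiD(3)[OF y(1)] using PhiD(1,2)[OF y(1)] by (intro dual_le_sum) auto
qed (use finite_Phi Phi_ne in auto)

lemma min_cost_le_dual:
  assumes "\<forall>i\<in>J. 0 \<le> c i"
  shows "\<exists>l\<in>insert 0 (c ` J). min_cost n p x c \<le> dual J q c l"
proof -
  obtain S l where S: "S \<subseteq> J" "card S = q" "l \<in> insert 0 (c ` J)" "sum c S \<le> dual J q c l"
    using dual_attained[OF finite_J q_le_card_J assms] by blast
  obtain y where y: "y \<in> Phi n p x" "cost n c y = sum c S" using indicator_in_Phi[OF S(1,2)] by blast
  have "min_cost n p x c \<le> cost n c y" unfolding min_cost_def using finite_Phi y(1) by (intro Min_le) auto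
  then have "min_cost n p x c \<le> dual J q c l" using S(4) y(2) by simp
  then show ?thesis using S(3) by blast
qed

lemma dual_cong:
  assumes "\<forall>i\<in>J. c i = c' i"
  shows "dual J q c l = dual J q c' l"
  using assms unfolding dual_def by (auto intro!: sum.cong)

text \<open>The count of raised items may fall short of \<open>card D\<close>, as items with equal
  bounds have zero increase; an inequality of cardinalities is enough.\<close>

lemma scen_in_Ud:
  assumes "feasible D"
  shows "(\<lambda>i\<in>{1..n}. scen D i) \<in> Ud n lo hi \<Gamma>"
proof -
  define \<delta> where "\<delta> i = (if i \<in> D then hi i - lo i else 0)" for i
  have "finite D" using assms finite_subset[of D J] by (auto simp: feasible_def)
  then have "card {i\<in>{1..n}. \<delta> i \<noteq> 0} \<le> card D" by (intro card_mono) (auto simp: \<delta>_def)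
  then have "real (card {i\<in>{1..n}. \<delta> i \<noteq> 0}) \<le> \<Gamma>" using assms by (simp add: feasible_def)
  moreover have "(\<lambda>i\<in>{1..n}. scen D i) = (\<lambda>i\<in>{1..n}. lo i + \<delta> i)" by (auto simp: scen_def \<delta>_def)
  ultimately show ?thesis unfolding Ud_def by (auto intro!: exI[of _ \<delta>] simp: \<delta>_def)
qed

text \<open>Raises outside \<open>J\<close> are dropped: second-stage solutions vanish there, so
  only agreement on \<open>J\<close> matters.\<close>

lemma Ud_scen:
  assumes "c \<in> Ud n lo hi \<Gamma>"
  shows "\<exists>D. feasible D \<and> (\<forall>i\<in>J. c i = scen D i)"
proof -
  obtain \<delta> where d: "c = (\<lambda>i\<in>{1..n}. lo i + \<delta> i)" "\<forall>i\<in>{1..n}. \<delta> i \<in> {0, hi i - lo i}"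
    "real (card {i\<in>{1..n}. \<delta> i \<noteq> 0}) \<le> \<Gamma>"
    using assms unfolding Ud_def by blast
  let ?D = "{i\<in>J. \<delta> i \<noteq> 0}"
  have "card ?D \<le> card {i\<in>{1..n}. \<delta> i \<noteq> 0}" using J_subset by (intro card_mono) auto
  then have "feasible ?D" using d(3) by (auto simp: feasible_def)
  moreover have "c i = scen ?D i" if i: "i \<in> J" for i
  proof -
    have "i \<in> {1..n}" using i J_subset by blast
    then show ?thesis using d(1,2) i by (auto simp: scen_def)
  qed
  ultimately show ?thesis by blast
qed

text \<open>A squeeze. By weak duality \<open>v\<close> is at most the minimum cost under the
  scenario of \<open>D\<close>. Conversely, for any scenario strong duality needs only the
  multiplier 0, with dual value 0, or one of its own costs, which is some \<open>lo i\<close> or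
  \<open>hi i\<close> and is covered by \<open>dom\<close>.\<close>

lemma solution_if_dominating:
  assumes "feasible D" "v \<le> dual J q (scen D) l" "0 \<le> v"
    and dom: "\<And>E i. feasible E \<Longrightarrow> i \<in> {1..n} \<Longrightarrow>
      dual J q (scen E) (lo i) \<le> v \<and> dual J q (scen E) (hi i) \<le> v"
  shows "a2st_solution n p x lo hi \<Gamma> (\<lambda>i\<in>{1..n}. scen D i) v"
proof -
  let ?c = "\<lambda>i\<in>{1..n}. scen D i"
  have upper: "min_cost n p x c \<le> v" if c: "c \<in> Ud n lo hi \<Gamma>" for c
  proof -
    obtain E where E: "feasible E" "\<forall>i\<in>J. c i = scen E i" using Ud_scen[OF c] by blast
    have nonneg: "0 \<le> c i" if "i \<in> J" for i
      using E(2) lo_hi[of i] J_subset that by (auto simp: scen_def)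
    then obtain l where l: "l \<in> insert 0 (c ` J)" "min_cost n p x c \<le> dual J q c l"
      using min_cost_le_dual[of c] by blast
    have "dual J q c l \<le> v"
    proof (cases "l = 0")
      case True
      have "(\<Sum>i\<in>J. max 0 (0 - c i)) = 0" using nonneg by (intro sum.neutral) auto
      then show ?thesis using True assms(3) by (simp add: dual_def)
    next
      case False
      then obtain i where "i \<in> J" "l = scen E i" using l(1) E(2) by auto
      then have "dual J q (scen E) l \<le> v" using dom[OF E(1), of i] J_subset by (auto simp: scen_def[of E i])
      then show ?thesis using dual_cong[OF E(2)] by simp
    qed
    then show ?thesis using l(2) by simp
  qed
  have "v \<le> dual J q ?c l" using assms(2) dual_cong[of ?c "scen D" l] J_subset by (simp add: subset_iff)
  then have lower: "v \<le> min_cost n p x ?c" using dual_le_min_cost[of ?c l] by linarith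
  have eq: "min_cost n p x ?c = v" using upper[OF scen_in_Ud[OF assms(1)]] lower by simp
  have "a2st_value n p x lo hi \<Gamma> = v"
    unfolding a2st_value_def
  proof (rule Max_eqI)
    show "v \<in> min_cost n p x ` Ud n lo hi \<Gamma>" using eq scen_in_Ud[OF assms(1)] by (metis imageI)
  qed (use finite_Ud upper in auto)
  then show ?thesis using eq scen_in_Ud[OF assms(1)] by (simp add: a2st_solution_def)
qed

section \<open>Store invariants and the linear passes\<close>

abbreviation slack :: "nat \<Rightarrow> real" where "slack \<equiv> \<lambda>i. hi i - lo i"
abbreviation neg_lo :: "nat \<Rightarrow> real" where "neg_lo \<equiv> \<lambda>i. - lo i"

text \<open>All data that the search over multipliers reads but never writes.\<close>

definition ready :: "store \<Rightarrow> bool" where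
  "ready s \<longleftrightarrow> nats s ''n'' 0 = n \<and> reals s ''Gamma'' 0 = \<Gamma> \<and> reals s ''q'' 0 = real q \<and>
     (\<forall>i\<in>{1..n}. nats s ''x'' i = x i \<and> reals s ''lo'' i = lo i \<and> reals s ''hi'' i = hi i
       \<and> reals s ''d'' i = slack i \<and> nats s ''P'' (rank slack n i) = i \<and> nats s ''Q'' (rank neg_lo n i) = i)"

lemma ready_agree:
  assumes "ready s" "agree A B s s'" "A \<inter> {''n'', ''x'', ''P'', ''Q''} = {}"
    "B \<inter> {''Gamma'', ''q'', ''lo'', ''hi'', ''d''} = {}"
  shows "ready s'"
proof -
  have "nats s' a = nats s a" if "a \<in> {''n'', ''x'', ''P'', ''Q''}" for a
    using assms(2,3) that unfolding agree_def by blast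
  moreover have "reals s' a = reals s a" if "a \<in> {''Gamma'', ''q'', ''lo'', ''hi'', ''d''}" for a
    using assms(2,4) that unfolding agree_def by blast
  ultimately show ?thesis using assms(1) by (simp add: ready_def)
qed

definition chosen :: "store \<Rightarrow> nat set" where
  "chosen s = {j\<in>{1..n}. 0 < nats s ''in'' j}"

lemma insert_ivl: "1 \<le> k \<Longrightarrow> {1..<Suc k} = insert k {1..<k}"
  by auto

lemma sum_insert_ivl: "sum f (insert k {1..<k :: nat}) = sum f {1..<k} + (f k :: real)"
  by (subst sum.insert) auto

lemma runs_prepare:
  assumes "nats s ''n'' 0 = n" "nats s ''p'' 0 = p" "reals s ''q'' 0 = 0"
    and "\<forall>i\<in>{1..n}. nats s ''x'' i = x i \<and> reals s ''lo'' i = lo i \<and> reals s ''hi'' i = hi i"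
  shows "runs prepare s ((n + 2) * 100) (\<lambda>s'. agree {''i''} {''d'', ''e'', ''c'', ''q''} s s' \<and>
    reals s' ''q'' 0 = real q \<and>
    (\<forall>i\<in>{1..n}. reals s' ''d'' i = slack i \<and> reals s' ''e'' i = neg_lo i \<and> reals s' ''c'' i = lo i))"
proof -
  \<comment> \<open>The net change of \<open>q\<close> in round \<open>j\<close>; over all rounds
    the first terms add up to \<open>p\<close> because \<open>p \<le> n\<close>.\<close>
  define f where "f = (\<lambda>j. (if j \<le> p then 1 else 0) - real (x j))"
  define I where "I = (\<lambda>k (s' :: store). reals s' ''q'' 0 = (\<Sum>j\<in>{1..<k}. f j) \<and>
    (\<forall>i\<in>{1..<k}. reals s' ''d'' i = slack i \<and> reals s' ''e'' i = neg_lo i \<and> reals s' ''c'' i = lo i))"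
  have sum_f: "sum f {1..n} = real q"
  proof -
    have "(\<Sum>j\<in>{1..n}. if j \<le> p then 1 else 0) = real (card {j\<in>{1..n}. j \<le> p})"
      by (simp flip: sum.inter_filter)
    also have "{j\<in>{1..n}. j \<le> p} = {1..p}" using p_le by auto
    finally show ?thesis using sum_x_le
      by (simp add: f_def sum_subtractf q_def of_nat_diff)
  qed
  have "runs prepare s ((n + 2) * (80 + 13))
    (\<lambda>s'. agree {''i''} {''d'', ''e'', ''c'', ''q''} s s' \<and> I (Suc n) s')"
    unfolding prepare_def
  proof (rule runs_For_loop_free, goal_cases)
    \<comment> \<open>Goal 8 is the obligation for the loop body; the remaining premises of the rule
      are discharged by simplification at the end.\<close>
    case (8 k s')
    note k = 8(1,3)
    have eqs: "nats s' ''p'' 0 = p" "nats s' ''x'' k = x k" "reals s' ''lo'' k = lo k" "reals s' ''hi'' k = hi k"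
      using assms(2,4) 8(1,2) by (auto simp: agree_def)
    show ?case (is "agree _ _ _ ?s'' \<and> _")
    proof (intro conjI)
      show "agree {''i''} {''d'', ''e'', ''c'', ''q''} s' ?s''" by (simp add: k(2) eqs agree_def)
      show "nats ?s'' ''i'' 0 = k" by (simp add: k(2) eqs)
      have "reals ?s'' ''q'' 0 = reals s' ''q'' 0 + f k"
        using x_cases[OF k(1)] by (auto simp: k(2) eqs f_def)
      moreover have "\<forall>i\<in>insert k {1..<k}. reals ?s'' ''d'' i = slack i \<and> reals ?s'' ''e'' i = neg_lo i
          \<and> reals ?s'' ''c'' i = lo i"
        using 8(4) by (simp add: I_def k(2) eqs)
      ultimately show "I (Suc k) ?s''"
        using 8(4) k(1) unfolding I_def by (simp only: insert_ivl sum_insert_ivl atLeastAtMost_iff diff_diff_add)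
    qed
  qed (use assms in \<open>simp_all add: I_def\<close>)
  then show ?thesis
    by (rule runs_conseq) (simp_all only: I_def sum_f atLeastLessThanSuc_atLeastAtMost, simp, blast)
qed

lemma runs_mark:
  assumes "ready s" "reals s ''rem'' 0 = 0"
  shows "runs mark s ((n + 2) * 50) (\<lambda>s'. agree {''j'', ''in''} {''rem''} s s' \<and>
    chosen s' = J \<and> reals s' ''rem'' 0 = real (card J))"
proof -
  define f where "f = (\<lambda>j. if x j = 0 then 1 else 0 :: real)"
  define I where "I = (\<lambda>k (s' :: store). reals s' ''rem'' 0 = (\<Sum>j\<in>{1..<k}. f j) \<and>
    (\<forall>i\<in>{1..<k}. 0 < nats s' ''in'' i \<longleftrightarrow> x i = 0))"
  have sum_f: "sum f {1..n} = real (card J)"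
    unfolding f_def J_def by (simp flip: sum.inter_filter)
  have "runs mark s ((n + 2) * (37 + 13)) (\<lambda>s'. agree {''j'', ''in''} {''rem''} s s' \<and> I (Suc n) s')"
    unfolding mark_def
  proof (rule runs_For_loop_free, goal_cases)
    case (8 k s')
    note k = 8(1,3)
    have eqs: "nats s' ''x'' k = x k" using assms(1) 8(1,2) by (auto simp: agree_def ready_def)
    show ?case (is "agree _ _ _ ?s'' \<and> _")
    proof (intro conjI)
      show "agree {''j'', ''in''} {''rem''} s' ?s''" by (simp add: k(2) eqs agree_def)
      show "nats ?s'' ''j'' 0 = k" by (simp add: k(2) eqs)
      have "reals ?s'' ''rem'' 0 = reals s' ''rem'' 0 + f k" by (simp add: k(2) eqs f_def)
      moreover have "\<forall>i\<in>insert k {1..<k}. 0 < nats ?s'' ''in'' i \<longleftrightarrow> x i = 0"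
        using 8(4) by (simp add: I_def k(2) eqs)
      ultimately show "I (Suc k) ?s''"
        using 8(4) k(1) unfolding I_def by (simp only: insert_ivl sum_insert_ivl atLeastAtMost_iff diff_diff_add)
    qed
  qed (use assms in \<open>simp_all add: I_def ready_def\<close>)
  then show ?thesis
    by (rule runs_conseq)
      (simp_all only: I_def sum_f atLeastLessThanSuc_atLeastAtMost, simp_all add: chosen_def J_def cong: conj_cong)
qed

text \<open>When \<open>val\<close> enters as \<open>q\<close> times \<open>lam\<close>, it leaves
  as the dual value of the marked scenario.\<close>

lemma runs_evaluate:
  assumes "ready s"
  shows "runs evaluate s ((n + 2) * 100) (\<lambda>s'. agree {''j''} {''w'', ''val''} s s' \<and>
    (\<forall>i\<in>{1..n}. reals s' ''w'' i = scen (chosen s) i) \<and>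
    reals s' ''val'' 0 = reals s ''val'' 0 - (\<Sum>i\<in>J. max 0 (reals s ''lam'' 0 - scen (chosen s) i)))"
proof -
  let ?l = "reals s ''lam'' 0" and ?c = "scen (chosen s)"
  define f where "f = (\<lambda>j. if x j = 0 then max 0 (?l - ?c j) else 0)"
  define I where "I = (\<lambda>k (s' :: store). reals s' ''val'' 0 = reals s ''val'' 0 - (\<Sum>j\<in>{1..<k}. f j) \<and>
    (\<forall>i\<in>{1..<k}. reals s' ''w'' i = ?c i))"
  have "sum f {1..n} = sum f J" by (rule sum_split_J) (auto simp: f_def J_def)
  also have "\<dots> = (\<Sum>i\<in>J. max 0 (?l - ?c i))" by (intro sum.cong) (auto simp: f_def J_def)
  finally have sum_f: "sum f {1..n} = (\<Sum>i\<in>J. max 0 (?l - ?c i))" .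
  have "runs evaluate s ((n + 2) * (80 + 13)) (\<lambda>s'. agree {''j''} {''w'', ''val''} s s' \<and> I (Suc n) s')"
    unfolding evaluate_def
  proof (rule runs_For_loop_free, goal_cases)
    case (8 k s')
    note k = 8(1,3)
    have eqs: "nats s' ''x'' k = x k" "reals s' ''lo'' k = lo k" "reals s' ''hi'' k = hi k"
      "reals s' ''lam'' 0 = ?l" "0 < nats s' ''in'' k \<longleftrightarrow> k \<in> chosen s"
      using assms(1) 8(1,2) by (auto simp: agree_def ready_def chosen_def)
    show ?case (is "agree _ _ _ ?s'' \<and> _")
    proof (intro conjI)
      show "agree {''j''} {''w'', ''val''} s' ?s''" by (simp add: k(2) eqs agree_def)
      show "nats ?s'' ''j'' 0 = k" by (simp add: k(2) eqs)
      have "reals ?s'' ''val'' 0 = reals s' ''val'' 0 - f k" by (auto simp: k(2) eqs f_def scen_def)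
      moreover have "\<forall>i\<in>insert k {1..<k}. reals ?s'' ''w'' i = ?c i"
        using 8(4) by (simp add: I_def k(2) eqs scen_def)
      ultimately show "I (Suc k) ?s''"
        using 8(4) k(1) unfolding I_def by (simp only: insert_ivl sum_insert_ivl atLeastAtMost_iff diff_diff_add)
    qed
  qed (use assms in \<open>simp_all add: I_def ready_def\<close>)
  then show ?thesis
    by (rule runs_conseq) (simp_all only: I_def sum_f atLeastLessThanSuc_atLeastAtMost, simp, blast)
qed

lemma runs_record_best:
  assumes "ready s"
  shows "runs record_best s ((n + 2) * 60) (\<lambda>s'. agree {''j''} {''value'', ''c''} s s' \<and>
    (if reals s ''value'' 0 < reals s ''val'' 0
     then reals s' ''value'' 0 = reals s ''val'' 0 \<and> (\<forall>i\<in>{1..n}. reals s' ''c'' i = reals s ''w'' i)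
     else reals s' = reals s))"
proof -
  let ?b = "RLess (rvar ''value'') (rvar ''val'')"
  let ?P = "\<lambda>s'. agree {''j''} {''value'', ''c''} s s' \<and>
    (if reals s ''value'' 0 < reals s ''val'' 0
     then reals s' ''value'' 0 = reals s ''val'' 0 \<and> (\<forall>i\<in>{1..n}. reals s' ''c'' i = reals s ''w'' i)
     else reals s' = reals s)"
  let ?copy = "RWrite ''c'' (nvar ''j'') (RRead ''w'' (nvar ''j''))"
  have upd: "runs (Seq (RWrite ''value'' (NConst 0) (rvar ''val'')) (For ''j'' ?copy)) s (4 + (n + 2) * 20) ?P"
    if lt: "bval ?b s"
  proof (rule runs_Seq)
    let ?s = "rwrite ''value'' 0 (reals s ''val'' 0) s"
    show "runs (RWrite ''value'' (NConst 0) (rvar ''val'')) s 4 (\<lambda>s'. s' = ?s)"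
      by (intro runs_loop_free) simp_all
    fix s1 assume s1: "s1 = ?s"
    define I where "I = (\<lambda>k (s' :: store). \<forall>i\<in>{1..<k}. reals s' ''c'' i = reals s ''w'' i)"
    have "runs (For ''j'' ?copy) s1 ((n + 2) * (7 + 13)) (\<lambda>s'. agree {''j''} {''c''} s1 s' \<and> I (Suc n) s')"
    proof (rule runs_For_loop_free, goal_cases)
      case (8 k s')
      have "reals s' ''w'' k = reals s ''w'' k" using 8(2) s1 by (simp add: agree_def)
      moreover have "1 \<le> k" using 8(1) by simp
      ultimately show ?case using 8(3,4) unfolding I_def insert_ivl[OF \<open>1 \<le> k\<close>] by (simp add: agree_def)
    qed (use assms s1 in \<open>simp_all add: I_def ready_def\<close>)
    then show "runs (For ''j'' ?copy) s1 ((n + 2) * 20) ?P"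
    proof (rule runs_conseq)
      fix s' assume "agree {''j''} {''c''} s1 s' \<and> I (Suc n) s'"
      then show "?P s'"
        using lt s1 unfolding I_def atLeastLessThanSuc_atLeastAtMost by (simp add: agree_def)
    qed simp
  qed
  have "runs record_best s (1 + btime ?b + (4 + (n + 2) * 20)) ?P"
    unfolding record_best_def
  proof (rule runs_Cond)
    show "runs Skip s (4 + (n + 2) * 20) ?P" if "\<not> bval ?b s"
      using that by (intro runs_loop_free) (auto simp: agree_refl)
  qed (rule upd)
  then show ?thesis by (rule runs_conseq) simp_all
qed

section \<open>Discarding the items of least gain\<close>

definition top_gains :: "real \<Rightarrow> nat set \<Rightarrow> bool" where
  "top_gains l D \<longleftrightarrow> D \<subseteq> J \<and> (\<forall>i\<in>D. \<forall>j\<in>J - D. gain l j \<le> gain l i)"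

text \<open>The removed item is a minimum within \<open>D\<close>, so it joins the items dominated
  by the rest.\<close>

lemma top_gains_remove:
  assumes "top_gains l D" "w \<in> D" "\<forall>i\<in>D. gain l w \<le> gain l i"
  shows "top_gains l (D - {w})"
  using assms unfolding top_gains_def by blast

text \<open>Here \<open>s\<close> is the store in which the removal starts. The disjunction says
  that nothing was discarded without need, which on exit makes the marked set as large as the budget
  allows. The last clause says that no marked item lies before either pointer.\<close>

definition removing :: "store \<Rightarrow> store \<Rightarrow> bool" where
  "removing s s' \<longleftrightarrow> agree {''in'', ''a'', ''b''} {''rem''} s s' \<and>
     top_gains (reals s ''lam'' 0) (chosen s') \<and> reals s' ''rem'' 0 = real (card (chosen s')) \<and>
     (chosen s' = J \<or> \<Gamma> < real (card (chosen s')) + 1) \<and>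
     (\<forall>i\<in>chosen s'. nats s' ''a'' 0 \<le> rank slack n i \<and> nats s' ''b'' 0 \<le> rank neg_lo n i)"

text \<open>Each step advances a pointer or unmarks an item, so the removal is linear although one
  step may discard nothing.\<close>

definition work_left :: "store \<Rightarrow> nat" where
  "work_left s = (n - nats s ''a'' 0) + (n - nats s ''b'' 0) + card (chosen s)"

lemma finite_chosen [simp]: "finite (chosen s)"
  by (simp add: chosen_def)

text \<open>All of \<open>D\<close> has rank at least \<open>a\<close>, so the item in cell
  \<open>a\<close> has a least key compared with \<open>D\<close> even if it is not in
  \<open>D\<close> itself; in that case the pointer may advance. Nonemptiness of \<open>D\<close>
  keeps the pointer within the list.\<close>

lemma pointed_item:
  assumes "\<forall>i\<in>D. a \<le> rank key n i" "D \<noteq> {}" "D \<subseteq> {1..n}" "\<forall>i\<in>{1..n}. A (rank key n i) = i"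
  shows "a < n" "A a \<in> {1..n}" "rank key n (A a) = a" "\<forall>i\<in>D. key (A a) \<le> key i"
    "A a \<notin> D \<Longrightarrow> \<forall>i\<in>D. Suc a \<le> rank key n i"
proof -
  obtain i where i: "i \<in> D" using assms(2) by blast
  have "a \<le> rank key n i" "rank key n i < n" using i assms(1,3) rank_less[of i n key] by auto
  then show a: "a < n" by simp
  then have "a \<in> rank key n ` {1..n}" unfolding rank_image by simp
  then obtain u where u: "u \<in> {1..n}" "rank key n u = a" by blast
  have A: "A a = u" using u assms(4) by auto
  show "A a \<in> {1..n}" "rank key n (A a) = a" using u A by simp_all
  show "\<forall>i\<in>D. key (A a) \<le> key i"
  proof
    fix j assume j: "j \<in> D"
    have "rank key n (A a) \<le> rank key n j" using j assms(1) unfolding A u(2) by blast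
    moreover have "j \<in> {1..n}" using j assms(3) by blast
    ultimately show "key (A a) \<le> key j" by (rule key_le_of_rank_le[rotated])
  qed
  show "\<forall>i\<in>D. Suc a \<le> rank key n i" if "A a \<notin> D"
  proof
    fix j assume j: "j \<in> D"
    then have "j \<noteq> u" "j \<in> {1..n}" using that A assms(3) by blast+
    then have "rank key n j \<noteq> a" using u rank_eq_iff[of j n u key] by simp
    moreover have "a \<le> rank key n j" using assms(1) j by blast
    ultimately show "Suc a \<le> rank key n j" by simp
  qed
qed

text \<open>The least gain among the remaining items belongs to the one with the least slack or the one
  with the greatest lower cost, because a gain is the minimum of two quantities.\<close>

lemma runs_step:
  assumes "ready s" and rem: "removing s s'" and b: "\<Gamma> < reals s' ''rem'' 0"
  shows "runs step s' 100 (\<lambda>s''. removing s s'' \<and> work_left s'' < work_left s')"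
proof -
  let ?D = "chosen s'" and ?l = "reals s ''lam'' 0"
  define a b where "a = nats s' ''a'' 0" and "b = nats s' ''b'' 0"
  define u v where "u = nats s' ''P'' a" and "v = nats s' ''Q'' b"
  have ag: "agree {''in'', ''a'', ''b''} {''rem''} s s'" and tg: "top_gains ?l ?D"
    and rem_eq: "reals s' ''rem'' 0 = real (card ?D)"
    and pos: "\<forall>i\<in>?D. a \<le> rank slack n i" "\<forall>i\<in>?D. b \<le> rank neg_lo n i"
    using rem unfolding removing_def a_def b_def by blast+
  have ready': "ready s'" using assms(1) ag by (rule ready_agree) auto
  have lam: "reals s' ''lam'' 0 = ?l" using ag by (simp add: agree_def)
  have card: "\<Gamma> < real (card ?D)" using b rem_eq by simp
  have ne: "?D \<noteq> {}" using card Gamma_nonneg by auto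
  have sub: "?D \<subseteq> {1..n}" by (auto simp: chosen_def)
  have P: "\<forall>i\<in>{1..n}. nats s' ''P'' (rank slack n i) = i" and Q: "\<forall>i\<in>{1..n}. nats s' ''Q'' (rank neg_lo n i) = i"
    using ready' unfolding ready_def by blast+
  note u = pointed_item[OF pos(1) ne sub P, folded u_def]
  note v = pointed_item[OF pos(2) ne sub Q, folded v_def]
  have du: "reals s' ''d'' u = slack u" and lov: "reals s' ''lo'' v = lo v"
    using ready' u(2) v(2) unfolding ready_def by blast+
  have in_u: "0 < nats s' ''in'' u \<longleftrightarrow> u \<in> ?D" and in_v: "0 < nats s' ''in'' v \<longleftrightarrow> v \<in> ?D"
    using u(2) v(2) unfolding chosen_def by blast+
  have remove_item: "removing s s'' \<and> work_left s'' < work_left s'"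
    if w: "w \<in> ?D" "\<forall>i\<in>?D. gain ?l w \<le> gain ?l i"
      and s'': "s'' = nwrite ''in'' w 0 (rwrite ''rem'' 0 (reals s' ''rem'' 0 - 1) s')" for w s''
  proof -
    have D: "chosen s'' = ?D - {w}" by (auto simp: chosen_def s'')
    have "agree {''in'', ''a'', ''b''} {''rem''} s s''" using ag by (simp add: agree_def s'')
    moreover have "top_gains ?l (chosen s'')" unfolding D using tg w by (rule top_gains_remove)
    moreover have c: "card ?D = Suc (card (chosen s''))"
      unfolding D by (rule card_Suc_Diff1[OF finite_chosen w(1), symmetric])
    moreover have "reals s'' ''rem'' 0 = real (card (chosen s''))" using rem_eq c by (simp add: s'')
    moreover have "\<Gamma> < real (card (chosen s'')) + 1" using card c by simp
    moreover have "\<forall>i\<in>chosen s''. nats s'' ''a'' 0 \<le> rank slack n i \<and> nats s'' ''b'' 0 \<le> rank neg_lo n i"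
      using pos unfolding D by (simp add: s'' a_def b_def)
    ultimately have "removing s s''" unfolding removing_def by blast
    moreover have "work_left s'' < work_left s'" using c by (simp add: work_left_def s'')
    ultimately show ?thesis ..
  qed
  show ?thesis
  proof (rule runs_loop_free)
    show "removing s (outcome step s') \<and> work_left (outcome step s') < work_left s'"
    proof (cases "u \<in> ?D")
      case False
      then have out: "outcome step s' = nwrite ''a'' 0 (Suc a) s'"
        using in_u by (simp add: step_def flip: a_def u_def)
      have D: "chosen (outcome step s') = ?D" by (simp add: out chosen_def)
      have "removing s (outcome step s')"
        using rem u(5)[OF False] unfolding removing_def D by (simp add: out agree_def)
      moreover have "work_left (outcome step s') < work_left s'"
        using u(1) unfolding work_left_def D by (simp add: out flip: a_def)
      ultimately show ?thesis ..
    next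
      case uD: True
      show ?thesis
      proof (cases "v \<in> ?D")
        case False
        then have out: "outcome step s' = nwrite ''b'' 0 (Suc b) s'"
          using in_u in_v uD by (simp add: step_def flip: a_def u_def b_def v_def)
        have D: "chosen (outcome step s') = ?D" by (simp add: out chosen_def)
        have "removing s (outcome step s')"
          using rem v(5)[OF False] unfolding removing_def D by (simp add: out agree_def)
        moreover have "work_left (outcome step s') < work_left s'"
          using v(1) unfolding work_left_def D by (simp add: out flip: b_def)
        ultimately show ?thesis ..
      next
        case vD: True
        show ?thesis
        proof (cases "slack u < ?l - lo v")
          case True
          \<comment> \<open>\<open>slack u\<close> lies above \<open>gain ?l u\<close> and below
            both terms of every \<open>gain ?l i\<close> with \<open>i\<close> in \<open>?D\<close>.
            In the other case \<open>?l - lo v\<close> plays this role for \<open>v\<close>.\<close>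
          have "\<forall>i\<in>?D. gain ?l u \<le> gain ?l i"
          proof
            fix i assume "i \<in> ?D"
            then have "slack u \<le> slack i" "lo i \<le> lo v" using u(4) v(4) by auto
            then show "gain ?l u \<le> gain ?l i" using True unfolding gain_def by linarith
          qed
          then show ?thesis using True uD vD in_u in_v
            by (intro remove_item[of u])
              (simp_all add: step_def du lov lam flip: a_def u_def b_def v_def)
        next
          case False
          have "\<forall>i\<in>?D. gain ?l v \<le> gain ?l i"
          proof
            fix i assume "i \<in> ?D"
            then have "slack u \<le> slack i" "lo i \<le> lo v" using u(4) v(4) by auto
            then show "gain ?l v \<le> gain ?l i" using False unfolding gain_def by linarith
          qed
          then show ?thesis using False uD vD in_u in_v
            by (intro remove_item[of v])
              (simp_all add: step_def du lov lam flip: a_def u_def b_def v_def)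
        qed
      qed
    qed
  qed (simp_all add: step_def)
qed

lemma runs_remove:
  assumes "ready s" "chosen s = J" "reals s ''rem'' 0 = real (card J)" "nats s ''a'' 0 = 0" "nats s ''b'' 0 = 0"
  shows "runs remove s ((n + 2) * 400) (\<lambda>s'. agree {''in'', ''a'', ''b''} {''rem''} s s' \<and>
    feasible (chosen s') \<and>
    (\<forall>E. feasible E \<longrightarrow> dual J q (scen E) (reals s ''lam'' 0) \<le> dual J q (scen (chosen s')) (reals s ''lam'' 0)))"
proof -
  let ?b = "RLess (rvar ''Gamma'') (rvar ''rem'')"
  have Gamma: "reals s' ''Gamma'' 0 = \<Gamma>" if "removing s s'" for s'
    using that assms(1) by (simp add: removing_def agree_def ready_def)
  have init: "removing s s" using assms by (simp add: removing_def agree_refl top_gains_def)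
  have "runs remove s ((work_left s + 1) * (1 + btime ?b + 100)) (\<lambda>s'. removing s s' \<and> \<not> bval ?b s')"
    unfolding remove_def
  proof (rule runs_Loop)
    fix s' assume s': "removing s s'" "bval ?b s'"
    then show "runs step s' 100 (\<lambda>s''. removing s s'' \<and> work_left s'' < work_left s')"
      using assms(1) Gamma by (intro runs_step) simp_all
  qed (rule init)
  then show ?thesis
  proof (rule runs_conseq)
    have "card (chosen s) \<le> card {1..n}" by (intro card_mono) (auto simp: chosen_def)
    \<comment> \<open>Two pointers and the marked items, each worth at most \<open>n\<close>; a
      round costs 106, namely 6 for the test and at most 100 for the step.\<close>
    then have "work_left s \<le> 3 * n" by (simp add: work_left_def)
    then show "(work_left s + 1) * (1 + btime ?b + 100) \<le> (n + 2) * 400" by simp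
    fix s' assume s': "removing s s' \<and> \<not> bval ?b s'"
    let ?D = "chosen s'" and ?l = "reals s ''lam'' 0"
    have ag: "agree {''in'', ''a'', ''b''} {''rem''} s s'" and tg: "top_gains ?l ?D"
      and rem: "reals s' ''rem'' 0 = real (card ?D)" and full: "?D = J \<or> \<Gamma> < real (card ?D) + 1"
      using s' unfolding removing_def by blast+
    have D: "?D \<subseteq> J" "\<forall>i\<in>?D. \<forall>j\<in>J - ?D. gain ?l j \<le> gain ?l i"
      using tg unfolding top_gains_def by blast+
    have le: "real (card ?D) \<le> \<Gamma>" using s' Gamma[of s'] rem by simp
    have "dual J q (scen E) ?l \<le> dual J q (scen ?D) ?l" if E: "feasible E" for E
    proof -
      have E': "E \<subseteq> J" "real (card E) \<le> \<Gamma>" using E unfolding feasible_def by blast+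
      have "card E \<le> card ?D"
      proof (cases "?D = J")
        case True
        then show ?thesis using E'(1) by (simp add: card_mono)
      next
        case False
        \<comment> \<open>This replaces the floor of \<Gamma>: cardinalities are integers, so the
          strict bound gives \<open>card E \<le> card ?D\<close>.\<close>
        then have "real (card E) < real (card ?D) + 1" using full E'(2) by linarith
        then show ?thesis by linarith
      qed
      moreover have "\<forall>i\<in>J. lo i \<le> hi i" using lo_hi J_subset by blast
      ultimately show ?thesis
        using dual_raise_greedy[OF finite_J D(1) E'(1), of lo hi ?l] D(2)
        unfolding scen_def[abs_def] gain_def by blast
    qed
    then show "agree {''in'', ''a'', ''b''} {''rem''} s s' \<and> feasible ?D \<and>
      (\<forall>E. feasible E \<longrightarrow> dual J q (scen E) ?l \<le> dual J q (scen ?D) ?l)"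
      using ag D(1) le unfolding feasible_def by blast
  qed
qed

section \<open>Search over the multipliers\<close>

definition incumbent :: "store \<Rightarrow> bool" where
  "incumbent s \<longleftrightarrow> ready s \<and> 0 \<le> reals s ''value'' 0 \<and>
     (\<exists>D l. feasible D \<and> (\<forall>i\<in>{1..n}. reals s ''c'' i = scen D i) \<and> reals s ''value'' 0 \<le> dual J q (scen D) l)"

definition dominates :: "real \<Rightarrow> real \<Rightarrow> bool" where
  "dominates v l \<longleftrightarrow> (\<forall>E. feasible E \<longrightarrow> dual J q (scen E) l \<le> v)"

text \<open>The pass computes the best dual value for the multiplier read from \<open>K\<close>.
  Either it replaces the incumbent, with that multiplier as its certificate, or the old value is
  already at least as large and so dominates it.\<close>

lemma runs_examine:
  assumes "incumbent s"
  shows "runs (examine K) s ((n + 2) * 700) (\<lambda>s'.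
    agree {''a'', ''b'', ''in'', ''j''} {''lam'', ''val'', ''rem'', ''w'', ''value'', ''c''} s s' \<and>
    incumbent s' \<and> reals s ''value'' 0 \<le> reals s' ''value'' 0 \<and>
    dominates (reals s' ''value'' 0) (reals s K (nats s ''i'' 0)))"
proof -
  let ?l = "reals s K (nats s ''i'' 0)"
  let ?P = "\<lambda>s'. agree {''a'', ''b'', ''in'', ''j''} {''lam'', ''val'', ''rem'', ''w'', ''value'', ''c''} s s' \<and>
    incumbent s' \<and> reals s ''value'' 0 \<le> reals s' ''value'' 0 \<and> dominates (reals s' ''value'' 0) ?l"
  have ready: "ready s" using assms by (simp add: incumbent_def)
  then have q: "reals s ''q'' 0 = real q" by (simp add: ready_def)
  have "runs (examine K) s (40 + ((n + 2) * 50 + ((n + 2) * 400 + ((n + 2) * 100 + (n + 2) * 60)))) ?P"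
    unfolding examine_def
  proof (rule runs_Seq)
    show "runs (start_with K) s 40 (\<lambda>s1. agree {''a'', ''b''} {''lam'', ''val'', ''rem''} s s1 \<and>
      reals s1 ''lam'' 0 = ?l \<and> reals s1 ''val'' 0 = real q * ?l \<and> reals s1 ''rem'' 0 = 0 \<and>
      nats s1 ''a'' 0 = 0 \<and> nats s1 ''b'' 0 = 0)"
      unfolding start_with_def by (intro runs_loop_free) (simp_all add: agree_def q)
    fix s1 assume s1: "agree {''a'', ''b''} {''lam'', ''val'', ''rem''} s s1 \<and>
      reals s1 ''lam'' 0 = ?l \<and> reals s1 ''val'' 0 = real q * ?l \<and> reals s1 ''rem'' 0 = 0 \<and>
      nats s1 ''a'' 0 = 0 \<and> nats s1 ''b'' 0 = 0"
    then have ready1: "ready s1" by (intro ready_agree[OF ready]) auto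
    show "runs (Seq mark (Seq remove (Seq evaluate record_best))) s1
      ((n + 2) * 50 + ((n + 2) * 400 + ((n + 2) * 100 + (n + 2) * 60))) ?P"
    proof (rule runs_Seq[OF runs_mark[OF ready1]])
      show "reals s1 ''rem'' 0 = 0" using s1 by blast
      fix s2 assume s2: "agree {''j'', ''in''} {''rem''} s1 s2 \<and> chosen s2 = J \<and> reals s2 ''rem'' 0 = real (card J)"
      then have ready2: "ready s2" by (intro ready_agree[OF ready1]) auto
      have ab2: "nats s2 ''a'' 0 = 0" "nats s2 ''b'' 0 = 0" and lam2: "reals s2 ''lam'' 0 = ?l"
        using s1 s2 by (simp_all add: agree_def)
      show "runs (Seq remove (Seq evaluate record_best)) s2
        ((n + 2) * 400 + ((n + 2) * 100 + (n + 2) * 60)) ?P"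
      proof (rule runs_Seq[OF runs_remove[OF ready2 _ _ ab2]])
        show "chosen s2 = J" "reals s2 ''rem'' 0 = real (card J)" using s2 by blast+
        fix s3 assume s3: "agree {''in'', ''a'', ''b''} {''rem''} s2 s3 \<and> feasible (chosen s3) \<and>
          (\<forall>E. feasible E \<longrightarrow> dual J q (scen E) (reals s2 ''lam'' 0) \<le> dual J q (scen (chosen s3)) (reals s2 ''lam'' 0))"
        then have ready3: "ready s3" by (intro ready_agree[OF ready2]) auto
        show "runs (Seq evaluate record_best) s3 ((n + 2) * 100 + (n + 2) * 60) ?P"
        proof (rule runs_Seq[OF runs_evaluate[OF ready3]])
          let ?D = "chosen s3"
          fix s4 assume s4: "agree {''j''} {''w'', ''val''} s3 s4 \<and>
            (\<forall>i\<in>{1..n}. reals s4 ''w'' i = scen ?D i) \<and>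
            reals s4 ''val'' 0 = reals s3 ''val'' 0 - (\<Sum>i\<in>J. max 0 (reals s3 ''lam'' 0 - scen ?D i))"
          then have ready4: "ready s4" by (intro ready_agree[OF ready3]) auto
          have lam3: "reals s3 ''lam'' 0 = ?l" and val3: "reals s3 ''val'' 0 = real q * ?l"
            using s1 s2 s3 by (simp_all add: agree_def)
          have val4: "reals s4 ''val'' 0 = dual J q (scen ?D) ?l"
            using s4 lam3 val3 by (simp add: dual_def)
          have dom: "dominates (dual J q (scen ?D) ?l) ?l" using s3 lam2 by (simp add: dominates_def)
          have ag: "agree {''a'', ''b'', ''in'', ''j''} {''lam'', ''val'', ''rem'', ''w'', ''value'', ''c''} s s4"
            using s1 s2 s3 s4 by (simp add: agree_def)
          have old: "reals s4 ''value'' = reals s ''value''" "reals s4 ''c'' = reals s ''c''"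
            using s1 s2 s3 s4 by (simp_all add: agree_def)
          show "runs record_best s4 ((n + 2) * 60) ?P"
          proof (rule runs_conseq[OF runs_record_best[OF ready4]])
            fix s5 assume s5: "agree {''j''} {''value'', ''c''} s4 s5 \<and>
              (if reals s4 ''value'' 0 < reals s4 ''val'' 0
               then reals s5 ''value'' 0 = reals s4 ''val'' 0 \<and> (\<forall>i\<in>{1..n}. reals s5 ''c'' i = reals s4 ''w'' i)
               else reals s5 = reals s4)"
            then have ready5: "ready s5" by (intro ready_agree[OF ready4]) auto
            have ag5: "agree {''a'', ''b'', ''in'', ''j''} {''lam'', ''val'', ''rem'', ''w'', ''value'', ''c''} s s5"
              using ag s5 by (elim conjE) (rule agree_trans, auto)
            show "?P s5"
            proof (cases "reals s ''value'' 0 < dual J q (scen ?D) ?l")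
              case True
              then have v: "reals s5 ''value'' 0 = dual J q (scen ?D) ?l" "\<forall>i\<in>{1..n}. reals s5 ''c'' i = scen ?D i"
                using s5 s4 val4 old by simp_all
              have "0 \<le> reals s ''value'' 0" using assms by (simp add: incumbent_def)
              then have "incumbent s5" unfolding incumbent_def v(1)
                using ready5 v(2) s3 True by fastforce
              then show ?thesis using ag5 v dom True by simp
            next
              case False
              then have eq: "reals s5 ''value'' = reals s ''value''" "reals s5 ''c'' = reals s ''c''"
                using s5 val4 old by simp_all
              have "incumbent s5" using assms ready5 unfolding incumbent_def eq by blast
              moreover have "dominates (reals s ''value'' 0) ?l"
                using dom False unfolding dominates_def by fastforce
              ultimately show ?thesis using ag5 eq by simp
            qed
          qed simp
        qed
      qed
    qed
  qed
  then show ?thesis by (rule runs_conseq) simp_all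
qed

text \<open>The incumbent value never decreases, so a multiplier once dominated stays
  dominated.\<close>

lemma runs_search:
  assumes "incumbent s"
  shows "runs (For ''i'' (Seq (examine ''lo'') (examine ''hi''))) s ((n + 2) * ((n + 2) * 1500))
    (\<lambda>s'. incumbent s' \<and> (\<forall>i\<in>{1..n}. dominates (reals s' ''value'' 0) (lo i) \<and> dominates (reals s' ''value'' 0) (hi i)))"
proof -
  define I where "I = (\<lambda>k (s' :: store). incumbent s' \<and>
    (\<forall>i\<in>{1..<k}. dominates (reals s' ''value'' 0) (lo i) \<and> dominates (reals s' ''value'' 0) (hi i)))"
  have mono: "dominates w l" if "dominates v l" "v \<le> w" for v w l
    using that unfolding dominates_def by fastforce
  have I_nwrite: "I k (nwrite ''i'' 0 a t) = I k t" for k a t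
    by (simp add: I_def incumbent_def ready_def)
  have n: "nats s' ''n'' 0 = n" if "incumbent s'" for s' using that by (simp add: incumbent_def ready_def)
  show ?thesis
  proof (rule runs_conseq[OF runs_For[where I = I and n = n and T = "(n + 2) * 700 + (n + 2) * 700" and Q = "I (Suc n)"]])
    show "(n + 2) * ((n + 2) * 700 + (n + 2) * 700 + 13) \<le> (n + 2) * ((n + 2) * 1500)"
      by (intro mult_le_mono2) simp
    show "I 1 (nwrite ''i'' 0 1 s)" unfolding I_nwrite using assms by (simp add: I_def)
    show "incumbent s' \<and> (\<forall>i\<in>{1..n}. dominates (reals s' ''value'' 0) (lo i) \<and> dominates (reals s' ''value'' 0) (hi i))"
      if "I (Suc n) s'" for s'
      using that unfolding I_def atLeastLessThanSuc_atLeastAtMost .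
    fix k s' assume k: "k \<in> {1..n}" "I k s'" "nats s' ''i'' 0 = k" "nats s' ''n'' 0 = n"
    have inc: "incumbent s'" using k(2) by (simp add: I_def)
    show "runs (Seq (examine ''lo'') (examine ''hi'')) s' ((n + 2) * 700 + (n + 2) * 700)
      (\<lambda>s''. nats s'' ''i'' 0 = k \<and> nats s'' ''n'' 0 = n \<and> I (Suc k) (nwrite ''i'' 0 (Suc k) s''))"
    proof (rule runs_Seq[OF runs_examine[OF inc]], elim conjE)
      fix s1
      assume s1: "agree {''a'', ''b'', ''in'', ''j''} {''lam'', ''val'', ''rem'', ''w'', ''value'', ''c''} s' s1"
        "incumbent s1" "reals s' ''value'' 0 \<le> reals s1 ''value'' 0"
        "dominates (reals s1 ''value'' 0) (reals s' ''lo'' (nats s' ''i'' 0))"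
      show "runs (examine ''hi'') s1 ((n + 2) * 700)
        (\<lambda>s''. nats s'' ''i'' 0 = k \<and> nats s'' ''n'' 0 = n \<and> I (Suc k) (nwrite ''i'' 0 (Suc k) s''))"
      proof (rule runs_conseq[OF runs_examine[OF s1(2)]], simp, elim conjE, intro conjI)
        fix s2
        assume s2: "agree {''a'', ''b'', ''in'', ''j''} {''lam'', ''val'', ''rem'', ''w'', ''value'', ''c''} s1 s2"
          "incumbent s2" "reals s1 ''value'' 0 \<le> reals s2 ''value'' 0"
          "dominates (reals s2 ''value'' 0) (reals s1 ''hi'' (nats s1 ''i'' 0))"
        have i1: "nats s1 ''i'' 0 = k" using s1(1) k(3) by (simp add: agree_def)
        then show "nats s2 ''i'' 0 = k" using s2(1) by (simp add: agree_def)
        show "nats s2 ''n'' 0 = n" using n[OF s2(2)] .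
        have "reals s' ''lo'' k = lo k" "reals s1 ''hi'' k = hi k"
          using inc s1(2) k(1) by (simp_all add: incumbent_def ready_def)
        then have "dominates (reals s2 ''value'' 0) (lo k)" "dominates (reals s2 ''value'' 0) (hi k)"
          using s1(4) s2(3,4) k(3) i1 mono by auto
        moreover have "\<forall>i\<in>{1..<k}. dominates (reals s2 ''value'' 0) (lo i) \<and> dominates (reals s2 ''value'' 0) (hi i)"
          using k(2) s1(3) s2(3) mono unfolding I_def by (meson order_trans)
        ultimately have "I (Suc k) s2"
          using s2(2) insert_ivl[of k] k(1) unfolding I_def by simp
        then show "I (Suc k) (nwrite ''i'' 0 (Suc k) s2)" unfolding I_nwrite .
      qed
    qed
  qed (use n[OF assms] in simp_all)
qed

lemma runs_algorithm:
  "runs algorithm (a2st_input n p x lo hi \<Gamma>) (2000 * (n + 2) ^ 2)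
    (\<lambda>s. a2st_solution n p x lo hi \<Gamma> (restrict (reals s ''c'') {1..n}) (reals s ''value'' 0))"
proof -
  let ?s = "a2st_input n p x lo hi \<Gamma>" and ?N = "n + 2"
  let ?P = "\<lambda>s. a2st_solution n p x lo hi \<Gamma> (restrict (reals s ''c'') {1..n}) (reals s ''value'' 0)"
  have "runs algorithm ?s (?N * 100 + (?N * (?N * 60 + 30) + (?N * (?N * 60 + 30) + ?N * (?N * 1500)))) ?P"
    unfolding algorithm_def
  proof (rule runs_Seq[OF runs_prepare])
    fix s1 assume s1: "agree {''i''} {''d'', ''e'', ''c'', ''q''} ?s s1 \<and> reals s1 ''q'' 0 = real q \<and>
      (\<forall>i\<in>{1..n}. reals s1 ''d'' i = slack i \<and> reals s1 ''e'' i = neg_lo i \<and> reals s1 ''c'' i = lo i)"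
    have n1: "nats s1 ''n'' 0 = n" using s1 by (simp add: agree_def a2st_input_def)
    have rank1: "rank (reals s1 ''d'') n i = rank slack n i" "rank (reals s1 ''e'') n i = rank neg_lo n i"
      if "i \<in> {1..n}" for i
      using s1 that by (auto intro!: rank_cong)
    show "runs (Seq (sort_by ''d'' ''P'') (Seq (sort_by ''e'' ''Q'')
      (For ''i'' (Seq (examine ''lo'') (examine ''hi''))))) s1
      (?N * (?N * 60 + 30) + (?N * (?N * 60 + 30) + ?N * (?N * 1500))) ?P"
    proof (rule runs_Seq[OF runs_sort_by[OF n1]])
      fix s2 assume s2: "agree {''i'', ''j'', ''r'', ''P''} {} s1 s2 \<and>
        (\<forall>i\<in>{1..n}. nats s2 ''P'' (rank (reals s1 ''d'') n i) = i)"
      have n2: "nats s2 ''n'' 0 = n" using s2 n1 by (simp add: agree_def)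
      have e2: "reals s2 ''e'' = reals s1 ''e''" using s2 by (simp add: agree_def)
      show "runs (Seq (sort_by ''e'' ''Q'') (For ''i'' (Seq (examine ''lo'') (examine ''hi'')))) s2
        (?N * (?N * 60 + 30) + ?N * (?N * 1500)) ?P"
      proof (rule runs_Seq[OF runs_sort_by[OF n2]])
        fix s3 assume s3: "agree {''i'', ''j'', ''r'', ''Q''} {} s2 s3 \<and>
          (\<forall>i\<in>{1..n}. nats s3 ''Q'' (rank (reals s2 ''e'') n i) = i)"
        note ag = conjunct1[OF s1] conjunct1[OF s2] conjunct1[OF s3]
        have reals3: "reals s3 a = reals s1 a" for a using ag by (simp add: agree_def)
        have nats3: "nats s3 a = nats ?s a" if "a = ''n'' \<or> a = ''x''" for a
          using ag that by (elim disjE) (simp_all add: agree_def)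
        have input3: "reals s3 a = reals ?s a" if "a \<in> {''lo'', ''hi'', ''Gamma'', ''value''}" for a
        proof -
          have "a \<notin> {''d'', ''e'', ''c'', ''q''}" using that by auto
          then show ?thesis unfolding reals3 using ag(1) unfolding agree_def by blast
        qed
        have "nats s3 ''P'' = nats s2 ''P''" using ag(3) by (simp add: agree_def)
        then have "\<forall>i\<in>{1..n}. nats s3 ''P'' (rank slack n i) = i \<and> nats s3 ''Q'' (rank neg_lo n i) = i"
          using s2 s3 rank1 e2 by simp
        then have "ready s3"
          using s1 nats3 input3 unfolding ready_def by (simp add: reals3[of "''d''"] reals3[of "''q''"] a2st_input_def)
        \<comment> \<open>\<open>value\<close> has not been written yet, so this is the initial zero
          of the memory; it is certified by the scenario without raised items and the multiplier
          0.\<close>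
        moreover have "reals s3 ''value'' 0 = 0" using input3 by (simp add: a2st_input_def)
        moreover have "feasible {}" using Gamma_nonneg by (simp add: feasible_def)
        moreover have "\<forall>i\<in>{1..n}. reals s3 ''c'' i = scen {} i" using s1 reals3 by (simp add: scen_def)
        moreover have "0 \<le> dual J q (scen {}) 0"
        proof -
          have "(\<Sum>i\<in>J. max 0 (0 - scen {} i)) = 0"
            using lo_hi J_subset by (intro sum.neutral) (auto simp: scen_def)
          then show ?thesis by (simp add: dual_def)
        qed
        ultimately have "incumbent s3" unfolding incumbent_def by auto
        then show "runs (For ''i'' (Seq (examine ''lo'') (examine ''hi''))) s3 (?N * (?N * 1500)) ?P"
        proof (rule runs_conseq[OF runs_search])
          fix s assume s: "incumbent s \<and> (\<forall>i\<in>{1..n}. dominates (reals s ''value'' 0) (lo i) \<and> dominates (reals s ''value'' 0) (hi i))"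
          then obtain D l where D: "feasible D" "\<forall>i\<in>{1..n}. reals s ''c'' i = scen D i"
            "reals s ''value'' 0 \<le> dual J q (scen D) l" "0 \<le> reals s ''value'' 0"
            unfolding incumbent_def by blast
          have "restrict (reals s ''c'') {1..n} = restrict (scen D) {1..n}" using D(2) by (intro restrict_ext) blast
          then show "?P s" using solution_if_dominating[OF D(1,3,4)] s unfolding dominates_def by simp
        qed simp
      qed simp
    qed simp
  qed (simp_all add: a2st_input_def)
  then show ?thesis
    by (rule runs_conseq) (simp_all add: power2_eq_square algebra_simps)
qed

end

theorem theorem18:
  "\<exists>prog T. solves_a2st_in_time prog T \<and> (\<lambda>n. real (T n)) \<in> O(\<lambda>n. real n ^ 2)"
proof (intro exI conjI)
  show "solves_a2st_in_time algorithm (\<lambda>n. 2000 * (n + 2) ^ 2)"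
    unfolding solves_a2st_in_time_def
  proof (intro allI impI)
    fix n p x lo hi \<Gamma> assume "a2st_instance n p x lo hi \<Gamma>"
    then interpret a2st n p x lo hi \<Gamma> by unfold_locales
    show "\<exists>t s. exec algorithm (a2st_input n p x lo hi \<Gamma>) t s \<and> t \<le> 2000 * (n + 2) ^ 2 \<and>
      a2st_solution n p x lo hi \<Gamma> (restrict (reals s ''c'') {1..n}) (reals s ''value'' 0)"
      using runs_algorithm unfolding runs_def .
  qed
  show "(\<lambda>n. real (2000 * (n + 2) ^ 2)) \<in> O(\<lambda>n. real n ^ 2)"
  proof (rule bigoI)
    \<comment> \<open>For positive \<open>n\<close>, \<open>n + 2\<close> is at most three times
      \<open>n\<close>; hence 18000 is 2000 times 9.\<close>
    have "real (n + 2) ^ 2 \<le> (3 * real n) ^ 2" if "n \<ge> 1" for n using that by (intro power_mono) auto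
    then show "\<forall>\<^sub>F n in at_top. norm (real (2000 * (n + 2) ^ 2)) \<le> 18000 * norm (real n ^ 2)"
      by (intro eventually_sequentiallyI[of 1]) (simp add: power_mult_distrib)
  qed
qed

end
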